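(* Let $\{|\varphi_i\rangle\}_{i\in\mathcal I}$ be a finite set of pure states on $\mathbb{C}^d$ with $\varphi_i=|\varphi_i\rangle\langle\varphi_i|$. Let $G$ be a finite group acting on $\mathcal I$, with unitaries $U_g$ on $\mathbb{C}^d$ such that $\varphi_{gi}=U_g\varphi_iU_g^\dagger$ for all $g\in G$, $i\in\mathcal I$. Let $\mathbf P$ be a nonempty convex set of probability distributions on $\mathcal I$ that is stable under the induced action, i.e. $p\in\mathbf P$ implies $p^g\in\mathbf P$ for all $g$, where $p^g(i)=p(g^{-1}i)$. Let $\mathbf P^G=\{p\in\mathbf P: p^g=p\ \forall g\in G\}$. Then for every $R\ge0$, $M(\mathcal{E},\mathbf P,R)=M(\mathcal{E},\mathbf P^G,R)$.
   Context: For a distribution $p$ on $\mathcal I$, $M(\mathcal{E},p,R)$ is defined as follows. For a finite set $\mathcal J$ and conditional distribution $p(j|i)$, let $\rho^{ABC}=\sum_ip(i)|i\rangle\langle i|\otimes\varphi_i\otimes\sum_jp(j|i)|j\rangle\langle j|$, with $S(A:C)=S(A)+S(C)-S(AC)$ and $S(A:B|C)=S(AC)+S(BC)-S(ABC)-S(C)$ (von Neumann entropies, base 2). Then $M(\mathcal{E},p,R)=\inf\{S(A:B|C):S(A:C)\le R\}$ over all finite $\mathcal J$ and conditional distributions. For a set $\mathbf S$ of distributions, $M(\mathcal{E},\mathbf S,R)=\sup_{p\in\mathrm{conv}(\mathbf S)}M(\mathcal{E},p,R)$. *)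

theory Defs
  imports "Jordan_Normal_Form.Schur_Decomposition" "HOL-Algebra.Group_Action"
begin

definition eta :: "real \<Rightarrow> real" where
  "eta x = (if x \<le> 0 then 0 else - x * log 2 x)"

definition eigvals :: "complex mat \<Rightarrow> complex list" where
  "eigvals A = (SOME as. char_poly A = (\<Prod>a\<leftarrow>as. [:- a, 1:]))"

text \<open>Von Neumann entropy S(rho) = - tr (rho log2 rho) = sum of eta over the
  eigenvalues of the (Hermitian, positive semidefinite) density matrix rho.\<close>
definition vN_entropy :: "complex mat \<Rightarrow> real" where
  "vN_entropy A = (\<Sum>a\<leftarrow>eigvals A. eta (Re a))"

text \<open>Basis vector |x>|y>|z> of C^a (x) C^b (x) C^c has index (x*b+y)*c+z.\<close>
definition enc3 :: "nat \<Rightarrow> nat \<Rightarrow> nat \<Rightarrow> nat \<Rightarrow> nat \<Rightarrow> nat" where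
  "enc3 b c x y z = (x * b + y) * c + z"

definition red_AC :: "nat \<Rightarrow> nat \<Rightarrow> nat \<Rightarrow> complex mat \<Rightarrow> complex mat" where
  "red_AC a b c M = mat (a * c) (a * c)
     (\<lambda>(r, s). \<Sum>y<b. M $$ (enc3 b c (r div c) y (r mod c), enc3 b c (s div c) y (s mod c)))"

definition red_BC :: "nat \<Rightarrow> nat \<Rightarrow> nat \<Rightarrow> complex mat \<Rightarrow> complex mat" where
  "red_BC a b c M = mat (b * c) (b * c)
     (\<lambda>(r, s). \<Sum>x<a. M $$ (enc3 b c x (r div c) (r mod c), enc3 b c x (s div c) (s mod c)))"

definition red_A :: "nat \<Rightarrow> nat \<Rightarrow> nat \<Rightarrow> complex mat \<Rightarrow> complex mat" where
  "red_A a b c M = mat a a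
     (\<lambda>(r, s). \<Sum>y<b. \<Sum>z<c. M $$ (enc3 b c r y z, enc3 b c s y z))"

definition red_C :: "nat \<Rightarrow> nat \<Rightarrow> nat \<Rightarrow> complex mat \<Rightarrow> complex mat" where
  "red_C a b c M = mat c c
     (\<lambda>(r, s). \<Sum>x<a. \<Sum>y<b. M $$ (enc3 b c x y r, enc3 b c x y s))"

definition mutual_info_AC :: "nat \<Rightarrow> nat \<Rightarrow> nat \<Rightarrow> complex mat \<Rightarrow> real" where
  "mutual_info_AC a b c M =
     vN_entropy (red_A a b c M) + vN_entropy (red_C a b c M) - vN_entropy (red_AC a b c M)"

definition cond_mutual_info :: "nat \<Rightarrow> nat \<Rightarrow> nat \<Rightarrow> complex mat \<Rightarrow> real" where
  "cond_mutual_info a b c M =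
     vN_entropy (red_AC a b c M) + vN_entropy (red_BC a b c M)
     - vN_entropy M - vN_entropy (red_C a b c M)"

text \<open>The index set I is {0..<n}; a pure state |phi_i> is a vector in C^d;
  phi_i = |phi_i><phi_i|.\<close>
definition proj :: "complex vec \<Rightarrow> complex mat" where
  "proj v = mat (dim_vec v) (dim_vec v) (\<lambda>(k, l). v $ k * cnj (v $ l))"

definition distr :: "nat \<Rightarrow> (nat \<Rightarrow> real) \<Rightarrow> bool" where
  "distr n p \<longleftrightarrow> (\<forall>i. 0 \<le> p i) \<and> (\<forall>i\<ge>n. p i = 0) \<and> (\<Sum>i<n. p i) = 1"

definition cond_distr :: "nat \<Rightarrow> nat \<Rightarrow> (nat \<Rightarrow> nat \<Rightarrow> real) \<Rightarrow> bool" where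
  "cond_distr n m K \<longleftrightarrow> (\<forall>i<n. distr m (K i))"

text \<open>rho^{ABC} = sum_i p(i) |i><i| (x) phi_i (x) sum_j p(j|i) |j><j|
  on C^n (x) C^d (x) C^m.\<close>
definition rho_ABC :: "nat \<Rightarrow> nat \<Rightarrow> (nat \<Rightarrow> complex vec) \<Rightarrow> (nat \<Rightarrow> real)
    \<Rightarrow> nat \<Rightarrow> (nat \<Rightarrow> nat \<Rightarrow> real) \<Rightarrow> complex mat" where
  "rho_ABC n d phi p m K = mat (n * d * m) (n * d * m)
     (\<lambda>(r, s). let i = r div (d * m); k = (r div m) mod d; j = r mod m;
                  i' = s div (d * m); k' = (s div m) mod d; j' = s mod m in
        if i = i' \<and> j = j' then complex_of_real (p i * K i j) * proj (phi i) $$ (k, k') else 0)"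

definition M_p :: "nat \<Rightarrow> nat \<Rightarrow> (nat \<Rightarrow> complex vec) \<Rightarrow> (nat \<Rightarrow> real) \<Rightarrow> real \<Rightarrow> real" where
  "M_p n d phi p R = Inf {cond_mutual_info n d m (rho_ABC n d phi p m K) | m K.
        cond_distr n m K \<and> mutual_info_AC n d m (rho_ABC n d phi p m K) \<le> R}"

definition conv_distr :: "(nat \<Rightarrow> real) set \<Rightarrow> (nat \<Rightarrow> real) set" where
  "conv_distr S = {p. \<exists>k (c :: nat \<Rightarrow> real) q. (\<forall>l<k. 0 \<le> c l \<and> q l \<in> S) \<and>
        (\<Sum>l<k. c l) = 1 \<and> p = (\<lambda>i. \<Sum>l<k. c l * q l i)}"

definition M_set :: "nat \<Rightarrow> nat \<Rightarrow> (nat \<Rightarrow> complex vec) \<Rightarrow> (nat \<Rightarrow> real) set \<Rightarrow> real \<Rightarrow> real" where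
  "M_set n d phi S R = Sup ((\<lambda>p. M_p n d phi p R) ` conv_distr S)"

definition act_distr :: "('g, 'b) monoid_scheme \<Rightarrow> ('g \<Rightarrow> nat \<Rightarrow> nat) \<Rightarrow> nat \<Rightarrow> 'g
    \<Rightarrow> (nat \<Rightarrow> real) \<Rightarrow> (nat \<Rightarrow> real)" where
  "act_distr G act n g p = (\<lambda>i. if i < n then p (act (inv\<^bsub>G\<^esub> g) i) else 0)"

definition unitary_mat :: "nat \<Rightarrow> complex mat \<Rightarrow> bool" where
  "unitary_mat d U \<longleftrightarrow> U \<in> carrier_mat d d \<and> U * mat_adjoint U = 1\<^sub>m d \<and> mat_adjoint U * U = 1\<^sub>m d"

end

theory Submission
  imports Defs
begin

text \<open>Since the states are pure, \<open>S(ABC) = S(AC)\<close>, so \<open>S(A:B|C)\<close> is the sum over the outputs \<open>j\<close> of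
  the gap \<open>S(\<sigma>) - \<eta>(tr \<sigma>)\<close> of the unnormalised conditional states
  \<open>\<sigma>\<^sub>j = \<Sum>\<^sub>i p(i) p(j|i) \<phi>\<^sub>i\<close>. This gap is unitarily invariant and superadditive in \<open>\<sigma>\<close>
  (concavity of the entropy), while \<open>S(A:C)\<close> is a classical mutual information, concave in \<open>p\<close>
  for a fixed channel. Given \<open>p\<close>, let \<open>r\<close> be the average of all \<open>p\<^sup>g\<close>. A channel for \<open>r\<close> yields one
  for \<open>p\<close>: draw \<open>g\<close> uniformly, apply the channel to \<open>g i\<close> and output \<open>g\<close> as well. By the two concavity
  properties both informations can only decrease, hence \<open>M(p) \<le> M(r)\<close> with \<open>r\<close> invariant.\<close>

section \<open>Eigenbases of Hermitian matrices\<close>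

text \<open>The label \<open>g\<close> stays in the output because the conditional state for the
  pair (g, j) is then a unitary rotation of the one that \<open>K\<close> produces from the moved
  distribution; forgetting \<open>g\<close> would mix states from differently rotated frames and
  could raise their entropy. Keeping it costs nothing: \<open>g\<close> is independent of the input,
  so its entropy log N enters S(C) and S(AC) equally and cancels in S(A:C). The obstacle on the
  matrix side is that \<open>vN_entropy\<close> reads an arbitrarily chosen list of roots of a
  characteristic polynomial. Entropies are therefore evaluated through orthonormal eigenbases, and
  concavity is obtained by comparing diagonals in the eigenbasis of the sum, which leaves a
  classical inequality between numbers. Inf and Sup of real sets are meaningful only for nonempty
  bounded sets: a one-letter channel, the nonnegativity of the gap and a dimension bound supply
  this.\<close>

definition cip :: "nat \<Rightarrow> (nat \<Rightarrow> complex) \<Rightarrow> (nat \<Rightarrow> complex) \<Rightarrow> complex" where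
  "cip n x y = (\<Sum>r<n. cnj (x r) * y r)"

definition mat_app :: "nat \<Rightarrow> complex mat \<Rightarrow> (nat \<Rightarrow> complex) \<Rightarrow> nat \<Rightarrow> complex" where
  "mat_app n A x = (\<lambda>r. \<Sum>s<n. A $$ (r, s) * x s)"

definition hermitian :: "nat \<Rightarrow> complex mat \<Rightarrow> bool" where
  "hermitian n A \<longleftrightarrow> A \<in> carrier_mat n n \<and> (\<forall>r<n. \<forall>s<n. A $$ (r, s) = cnj (A $$ (s, r)))"

definition orthonormal :: "nat \<Rightarrow> 't set \<Rightarrow> ('t \<Rightarrow> nat \<Rightarrow> complex) \<Rightarrow> bool" where
  "orthonormal n T v \<longleftrightarrow> finite T \<and> (\<forall>s\<in>T. \<forall>t\<in>T. cip n (v s) (v t) = (if s = t then 1 else 0))"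

text \<open>The index type is left free so that a block-diagonal matrix can be diagonalised by
  vectors indexed by pairs of block and position. Vectors are functions on the naturals of which
  only the entries below \<open>n\<close> matter, and \<open>card T = n\<close> turns orthonormality
  into completeness.\<close>

definition eigenbasis ::
  "nat \<Rightarrow> complex mat \<Rightarrow> 't set \<Rightarrow> ('t \<Rightarrow> nat \<Rightarrow> complex) \<Rightarrow> ('t \<Rightarrow> real) \<Rightarrow> bool" where
  "eigenbasis n A T v lam \<longleftrightarrow> A \<in> carrier_mat n n \<and> orthonormal n T v \<and> card T = n \<and>
     (\<forall>t\<in>T. \<forall>r<n. mat_app n A (v t) r = of_real (lam t) * v t r)"

lemma cip_cong: "(\<And>r. r < n \<Longrightarrow> x r = x' r) \<Longrightarrow> (\<And>r. r < n \<Longrightarrow> y r = y' r) \<Longrightarrow> cip n x y = cip n x' y'"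
  unfolding cip_def by (intro sum.cong) auto

lemma cip_scale_right: "cip n x (\<lambda>r. c * y r) = c * cip n x y"
  unfolding cip_def sum_distrib_left by (simp add: algebra_simps)

lemma cip_scale_left: "cip n (\<lambda>r. c * x r) y = cnj c * cip n x y"
  unfolding cip_def sum_distrib_left by (simp add: algebra_simps)

lemma cip_commute: "cip n y x = cnj (cip n x y)"
  unfolding cip_def by (simp add: mult.commute)

lemma cip_self: "cip n x x = of_real (\<Sum>r<n. (cmod (x r))\<^sup>2)"
  unfolding cip_def by (simp add: complex_norm_square mult.commute del: of_real_power)

lemma cip_self_pos: "r < n \<Longrightarrow> x r \<noteq> 0 \<Longrightarrow> (\<Sum>r<(n::nat). (cmod (x r))\<^sup>2) > 0"
  by (rule sum_pos2[of "{..<n}" r]) auto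

lemma hermitian_cip:
  assumes "hermitian n A"
  shows "cip n x (mat_app n A y) = cip n (mat_app n A x) y"
proof -
  have "cip n x (mat_app n A y) = (\<Sum>r<n. \<Sum>s<n. cnj (x r) * A $$ (r, s) * y s)"
    by (simp add: cip_def mat_app_def sum_distrib_left algebra_simps)
  also have "\<dots> = (\<Sum>s<n. \<Sum>r<n. cnj (x r) * A $$ (r, s) * y s)"
    by (rule sum.swap)
  also have "\<dots> = (\<Sum>s<n. \<Sum>r<n. cnj (A $$ (s, r) * x r) * y s)"
  proof (intro sum.cong refl)
    fix s r assume "s \<in> {..<n}" "r \<in> {..<n}"
    then have "A $$ (r, s) = cnj (A $$ (s, r))"
      using assms unfolding hermitian_def by blast
    then show "cnj (x r) * A $$ (r, s) * y s = cnj (A $$ (s, r) * x r) * y s"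
      by (simp add: mult.commute)
  qed
  also have "\<dots> = cip n (mat_app n A x) y"
    by (simp add: cip_def mat_app_def sum_distrib_left sum_distrib_right algebra_simps)
  finally show ?thesis .
qed

lemma eigenvalue_hermitian_real:
  assumes H: "hermitian n A" and ev: "\<And>r. r < n \<Longrightarrow> mat_app n A x r = \<mu> * x r"
    and nz: "r < n" "x r \<noteq> 0"
  shows "\<mu> \<in> \<real>"
proof -
  have "\<mu> * cip n x x = cip n x (mat_app n A x)"
    by (subst cip_scale_right[symmetric]) (auto intro: cip_cong simp: ev)
  also have "\<dots> = cip n (mat_app n A x) x"
    by (rule hermitian_cip[OF H])
  also have "\<dots> = cnj \<mu> * cip n x x"
    by (subst cip_scale_left[symmetric]) (auto intro: cip_cong simp: ev)
  finally have "\<mu> = cnj \<mu>"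
    using cip_self_pos[of r n x, OF nz] by (auto simp only: cip_self mult_right_cancel of_real_eq_0_iff)
  then show ?thesis
    by (simp add: Reals_cnj_iff)
qed

section \<open>Spectral theorem by deflation along the trace\<close>

lemma trace_similar:
  assumes A: "A \<in> carrier_mat n n" and sim: "similar_mat A B"
  shows "(\<Sum>r<n. A $$ (r, r)) = (\<Sum>r<n. B $$ (r, r) :: complex)"
proof -
  from sim obtain P Q where "similar_mat_wit A B P Q"
    unfolding similar_mat_def by auto
  note w = similar_mat_witD2[OF A this]
  have tr: "(\<Sum>r<n. (X * Y) $$ (r, r)) = (\<Sum>r<n. \<Sum>s<n. X $$ (r, s) * Y $$ (s, r))"
    if "X \<in> carrier_mat n n" "Y \<in> carrier_mat n n" for X Y :: "complex mat"
    using that by (intro sum.cong refl) (auto simp: scalar_prod_def atLeast0LessThan intro!: sum.cong)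
  have swap: "(\<Sum>r<n. (X * Y) $$ (r, r)) = (\<Sum>r<n. (Y * X) $$ (r, r))"
    if X: "X \<in> carrier_mat n n" and Y: "Y \<in> carrier_mat n n" for X Y :: "complex mat"
    unfolding tr[OF X Y] tr[OF Y X] by (subst sum.swap) (simp add: mult.commute)
  have "(\<Sum>r<n. A $$ (r, r)) = (\<Sum>r<n. (Q * (P * B)) $$ (r, r))"
    unfolding w(3) by (rule swap[OF mult_carrier_mat[OF w(6,5)] w(7)])
  also have "Q * (P * B) = B"
    using w by (metis assoc_mult_mat left_mult_one_mat)
  finally show ?thesis .
qed

text \<open>Schur triangularisation puts the eigenvalues on the diagonal, all equal to
  \<open>c\<close>, and similarity preserves the trace. Read contrapositively, any other trace
  forces an eigenvalue different from \<open>c\<close>, with no count of multiplicities.\<close>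

lemma trace_single_eigenvalue:
  fixes A :: "complex mat"
  assumes A: "A \<in> carrier_mat n n" and c: "\<And>a. eigenvalue A a \<Longrightarrow> a = c"
  shows "(\<Sum>r<n. A $$ (r, r)) = of_nat n * c"
proof -
  obtain as where as: "char_poly A = (\<Prod>a\<leftarrow>as. [:- a, 1:])"
    using char_poly_factorized[OF A] by auto
  obtain B where B: "B \<in> carrier_mat n n" "upper_triangular B" "similar_mat A B"
    using schur_decomposition_exists[OF A as] by auto
  have cp: "char_poly A = (\<Prod>a\<leftarrow>diag_mat B. [:- a, 1:])"
    using char_poly_similar[OF B(3)] char_poly_upper_triangular[OF B(1,2)] by simp
  have "B $$ (r, r) = c" if r: "r < n" for r
  proof -
    have "B $$ (r, r) \<in> set (diag_mat B)"
      using B(1) r by (auto simp: diag_mat_def)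
    then have "poly (char_poly A) (B $$ (r, r)) = 0"
      unfolding cp by (auto simp: poly_prod_list prod_list_zero_iff)
    then show ?thesis
      using c eigenvalue_root_char_poly[OF A] by blast
  qed
  then show ?thesis
    using trace_similar[OF A B(3)] by simp
qed

text \<open>One deflation step: replacing the eigenvalues found so far by a common real number \<open>c\<close> which
  is not the mean of the remaining ones forces a further eigenvalue \<open>\<noteq> c\<close>, and its eigenvector is
  orthogonal to the previous ones.\<close>

lemma hermitian_orthonormal_eigenvectors:
  assumes H: "hermitian n A" and "k \<le> n"
  shows "\<exists>v lam. orthonormal n {..<k} v \<and>
           (\<forall>t<k. \<forall>r<n. mat_app n A (v t) r = of_real (lam t) * v t r)"
  using \<open>k \<le> n\<close>
proof (induction k)
  case 0
  show ?case by (auto simp: orthonormal_def)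
next
  case (Suc k)
  then obtain v :: "nat \<Rightarrow> nat \<Rightarrow> complex" and lam :: "nat \<Rightarrow> real" where
    on: "orthonormal n {..<k} v" and
    ev: "\<And>t r. t < k \<Longrightarrow> r < n \<Longrightarrow> mat_app n A (v t) r = of_real (lam t) * v t r"
    by auto
  have on': "cip n (v s) (v t) = (if s = t then 1 else 0)" if "s < k" "t < k" for s t
    using on that by (auto simp: orthonormal_def)
  have A: "A \<in> carrier_mat n n"
    using H by (simp add: hermitian_def)
  define \<tau> where "\<tau> = Re (\<Sum>r<n. A $$ (r, r)) - (\<Sum>t<k. lam t)"
  \<comment> \<open>\<tau> is what the trace leaves for the remaining \<open>n - k\<close>
    eigenvalues. The added 1 moves \<open>c\<close> off their mean, so that (n - k) * c = \<tau>
    becomes impossible; \<open>n - k\<close> is positive because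
    \<open>Suc k \<le> n\<close>.\<close>
  define c where "c = \<tau> / real (n - k) + 1"
  \<comment> \<open>\<open>D\<close> multiplies each eigenvector found so far by \<open>c\<close>
    and agrees with \<open>A\<close> on their orthogonal complement.\<close>
  define D where "D = mat n n (\<lambda>(r, s). A $$ (r, s) - (\<Sum>t<k. of_real (lam t - c) * v t r * cnj (v t s)))"
  have D: "D \<in> carrier_mat n n"
    by (simp add: D_def)
  have "hermitian n D"
    unfolding hermitian_def
  proof (intro conjI allI impI D)
    fix r s assume rs: "r < n" "s < n"
    have "A $$ (r, s) = cnj (A $$ (s, r))"
      using H rs unfolding hermitian_def by blast
    moreover have "(\<Sum>t<k. of_real (lam t - c) * v t r * cnj (v t s))
        = cnj (\<Sum>t<k. of_real (lam t - c) * v t s * cnj (v t r))"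
      by (simp add: mult.assoc mult.commute mult.left_commute)
    ultimately show "D $$ (r, s) = cnj (D $$ (s, r))"
      using rs by (simp add: D_def)
  qed
  have app: "mat_app n D x r = mat_app n A x r - (\<Sum>t<k. of_real (lam t - c) * v t r * cip n (v t) x)"
    if "r < n" for x r
  proof -
    have "mat_app n D x r = mat_app n A x r - (\<Sum>s<n. \<Sum>t<k. of_real (lam t - c) * v t r * cnj (v t s) * x s)"
      using that by (simp add: mat_app_def D_def left_diff_distrib sum_subtractf sum_distrib_right)
    also have "(\<Sum>s<n. \<Sum>t<k. of_real (lam t - c) * v t r * cnj (v t s) * x s)
        = (\<Sum>t<k. of_real (lam t - c) * v t r * cip n (v t) x)"
      by (subst sum.swap) (simp add: cip_def sum_distrib_left mult.assoc)
    finally show ?thesis .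
  qed
  have Dv: "mat_app n D (v t) r = of_real c * v t r" if t: "t < k" and r: "r < n" for t r
  proof -
    have "(\<Sum>u<k. of_real (lam u - c) * v u r * cip n (v u) (v t))
        = (\<Sum>u<k. if u = t then of_real (lam u - c) * v u r else 0)"
      using t by (intro sum.cong refl) (auto simp: on')
    also have "\<dots> = of_real (lam t - c) * v t r"
      using t by simp
    finally show ?thesis
      using t r by (simp add: app ev algebra_simps)
  qed
  have "(\<Sum>r<n. D $$ (r, r)) = (\<Sum>r<n. A $$ (r, r)) - (\<Sum>t<k. of_real (lam t - c) * cip n (v t) (v t))"
    by (simp add: D_def sum_subtractf cip_def sum_distrib_left, subst sum.swap) (simp add: ac_simps)
  also have "(\<Sum>t<k. of_real (lam t - c) * cip n (v t) (v t)) = of_real (\<Sum>t<k. lam t - c)"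
    by (simp add: on')
  finally have trD: "Re (\<Sum>r<n. D $$ (r, r)) = \<tau> + real k * c"
    by (simp add: \<tau>_def sum_subtractf)
  have "\<exists>\<mu>. eigenvalue D \<mu> \<and> \<mu> \<noteq> of_real c"
  proof (rule ccontr)
    assume "\<not> ?thesis"
    then have "(\<Sum>r<n. D $$ (r, r)) = of_nat n * of_real c"
      by (intro trace_single_eigenvalue[OF D]) auto
    then have "\<tau> + real k * c = real n * c"
      using trD by simp
    then have "real (n - k) * c = \<tau>"
      using Suc.prems by (simp add: of_nat_diff algebra_simps)
    moreover have "real (n - k) * c = \<tau> + real (n - k)"
      using Suc.prems unfolding c_def by (simp add: distrib_left del: of_nat_diff)
    ultimately show False
      using Suc.prems by simp
  qed
  then obtain \<mu> w where w: "eigenvector D w \<mu>" and \<mu>: "\<mu> \<noteq> of_real c"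
    unfolding eigenvalue_def by auto
  define x where "x = (\<lambda>r. w $ r)"
  have wc: "w \<in> carrier_vec n" and w0: "w \<noteq> 0\<^sub>v n" and we: "D *\<^sub>v w = \<mu> \<cdot>\<^sub>v w"
    using w carrier_matD(1)[OF D] unfolding eigenvector_def by metis+
  obtain r0 where r0: "r0 < n" "x r0 \<noteq> 0"
  proof -
    have "\<exists>r<n. w $ r \<noteq> 0"
      using w0 by (rule contrapos_np) (use wc in \<open>auto intro!: eq_vecI\<close>)
    then show ?thesis
      using that by (auto simp: x_def)
  qed
  have Dx: "mat_app n D x r = \<mu> * x r" if r: "r < n" for r
  proof -
    have "(D *\<^sub>v w) $ r = \<mu> * w $ r"
      using we wc r by simp
    then show ?thesis
      using r D wc by (simp add: mat_app_def x_def scalar_prod_def atLeast0LessThan)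
  qed
  have orth: "cip n (v t) x = 0" if t: "t < k" for t
  proof -
    have "\<mu> * cip n (v t) x = cip n (v t) (mat_app n D x)"
      by (subst cip_scale_right[symmetric]) (auto intro: cip_cong simp: Dx)
    also have "\<dots> = cip n (mat_app n D (v t)) x"
      by (rule hermitian_cip[OF \<open>hermitian n D\<close>])
    also have "\<dots> = cip n (\<lambda>r. of_real c * v t r) x"
      by (rule cip_cong) (simp_all add: Dv t)
    also have "\<dots> = of_real c * cip n (v t) x"
      by (simp add: cip_scale_left)
    finally show ?thesis
      using \<mu> by simp
  qed
  \<comment> \<open>Orthogonality removes the correction terms, so the eigenvector of
    \<open>D\<close> is one of \<open>A\<close> for the same \<mu>.\<close>
  have Ax: "mat_app n A x r = \<mu> * x r" if "r < n" for r
    using app[OF that, of x] Dx[OF that] by (simp add: orth)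
  have \<mu>r: "\<mu> \<in> \<real>"
    by (rule eigenvalue_hermitian_real[OF H Ax r0])
  define a where "a = 1 / sqrt (\<Sum>r<n. (cmod (x r))\<^sup>2)"
  have pos: "(\<Sum>r<n. (cmod (x r))\<^sup>2) > 0"
    by (rule cip_self_pos[of r0]) (use r0 in auto)
  define y where "y = (\<lambda>r. of_real a * x r)"
  have "of_real (a * a * (\<Sum>r<n. (cmod (x r))\<^sup>2)) = (1::complex)"
    using pos unfolding a_def by (simp add: field_simps)
  then have yy: "cip n y y = 1"
    unfolding y_def cip_scale_left cip_scale_right cip_self by (simp add: mult.assoc)
  have vy: "cip n (v t) y = 0" if "t < k" for t
    using orth[OF that] by (simp add: y_def cip_scale_right)
  have yv: "cip n y (v t) = 0" if "t < k" for t
    using vy[OF that] by (subst cip_commute) simp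
  have Ay: "mat_app n A y r = of_real (Re \<mu>) * y r" if "r < n" for r
  proof -
    have "mat_app n A y r = of_real a * mat_app n A x r"
      by (simp add: mat_app_def y_def sum_distrib_left algebra_simps)
    then show ?thesis
      using \<mu>r by (simp add: Ax that y_def)
  qed
  have "orthonormal n {..<Suc k} (v(k := y))"
    by (auto simp: orthonormal_def less_Suc_eq yy vy yv on')
  moreover have "\<forall>t<Suc k. \<forall>r<n. mat_app n A ((v(k := y)) t) r
      = of_real ((lam(k := Re \<mu>)) t) * (v(k := y)) t r"
    by (auto simp: less_Suc_eq Ay ev)
  ultimately show ?case by blast
qed

lemma hermitian_eigenbasis:
  assumes "hermitian n A"
  obtains v lam where "eigenbasis n A {..<n} v lam"
proof -
  obtain v :: "nat \<Rightarrow> nat \<Rightarrow> complex" and lam :: "nat \<Rightarrow> real"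
    where "orthonormal n {..<n} v" "\<forall>t<n. \<forall>r<n. mat_app n A (v t) r = of_real (lam t) * v t r"
    using hermitian_orthonormal_eigenvectors[OF assms order_refl] by blast
  then have "eigenbasis n A {..<n} v lam"
    using assms by (simp add: eigenbasis_def hermitian_def)
  then show thesis by (rule that)
qed

text \<open>For square matrices a left inverse is a right inverse. Orthonormality makes the adjoint
  of the matrix of basis vectors a left inverse; the claim is an entry of the product in the other
  order.\<close>

lemma orthonormal_complete:
  assumes on: "orthonormal n T v" and card: "card T = n" and r: "r < n" and s: "s < n"
  shows "(\<Sum>t\<in>T. v t r * cnj (v t s)) = (if r = s then 1 else 0)"
proof -
  have "finite T" using on by (simp add: orthonormal_def)
  then obtain h where h: "bij_betw h {..<n} T"
    using card ex_bij_betw_nat_finite[of T] by (auto simp: atLeast0LessThan)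
  define V where "V = mat n n (\<lambda>(r, k). v (h k) r)"
  define W where "W = mat n n (\<lambda>(k, r). cnj (v (h k) r))"
  have hT: "h k \<in> T" if "k < n" for k
    using h that by (auto simp: bij_betw_def)
  have hinj: "h k = h l \<longleftrightarrow> k = l" if "k < n" "l < n" for k l
    using h that by (auto simp: bij_betw_def inj_on_def)
  have "W * V = 1\<^sub>m n"
  proof (rule eq_matI)
    fix i j assume "i < dim_row (1\<^sub>m n)" "j < dim_col (1\<^sub>m n)"
    then have ij: "i < n" "j < n" by auto
    then have "(W * V) $$ (i, j) = cip n (v (h i)) (v (h j))"
      by (simp add: W_def V_def scalar_prod_def cip_def atLeast0LessThan)
    also have "\<dots> = (if i = j then 1 else 0)"
      using on ij hT hinj by (auto simp: orthonormal_def)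
    finally show "(W * V) $$ (i, j) = 1\<^sub>m n $$ (i, j)"
      using ij by simp
  qed (auto simp: W_def V_def)
  then have "V * W = 1\<^sub>m n"
    by (intro mat_mult_left_right_inverse[of W n V]) (auto simp: W_def V_def)
  then have "(V * W) $$ (r, s) = 1\<^sub>m n $$ (r, s)" by simp
  then have "(\<Sum>k<n. v (h k) r * cnj (v (h k) s)) = (if r = s then 1 else 0)"
    using r s by (simp add: W_def V_def scalar_prod_def atLeast0LessThan)
  then show ?thesis
    using sum.reindex_bij_betw[OF h, of "\<lambda>t. v t r * cnj (v t s)"] by simp
qed

lemma eigenbasis_orthonormal: "eigenbasis n A T v lam \<Longrightarrow> orthonormal n T v"
  and eigenbasis_card: "eigenbasis n A T v lam \<Longrightarrow> card T = n"
  and eigenbasis_finite: "eigenbasis n A T v lam \<Longrightarrow> finite T"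
  by (auto simp: eigenbasis_def orthonormal_def)

lemma eigenbasis_spectral:
  assumes eb: "eigenbasis n A T v lam" and r: "r < n" and s: "s < n"
  shows "A $$ (r, s) = (\<Sum>t\<in>T. of_real (lam t) * v t r * cnj (v t s))"
proof -
  have "(\<Sum>t\<in>T. of_real (lam t) * v t r * cnj (v t s)) = (\<Sum>t\<in>T. mat_app n A (v t) r * cnj (v t s))"
    using eb r by (intro sum.cong refl) (auto simp: eigenbasis_def)
  also have "\<dots> = (\<Sum>q<n. A $$ (r, q) * (\<Sum>t\<in>T. v t q * cnj (v t s)))"
    by (simp add: mat_app_def sum_distrib_left sum_distrib_right mult.assoc, subst sum.swap) simp
  also have "\<dots> = (\<Sum>q<n. if q = s then A $$ (r, q) else 0)"
    using s by (intro sum.cong refl)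
      (auto simp: orthonormal_complete[OF eigenbasis_orthonormal[OF eb] eigenbasis_card[OF eb]])
  also have "\<dots> = A $$ (r, s)"
    using s by simp
  finally show ?thesis by simp
qed

text \<open>The SOME in \<open>eigvals\<close> fixes only some list of roots, but two factorisations
  of one polynomial into linear factors agree as multisets, and the entropy ignores the
  order.\<close>

lemma vN_entropy_char_poly:
  assumes "char_poly A = (\<Prod>a\<leftarrow>as. [:- a, 1:])"
  shows "vN_entropy A = (\<Sum>a\<leftarrow>as. eta (Re a))"
proof -
  have "char_poly A = (\<Prod>a\<leftarrow>eigvals A. [:- a, 1:])"
    unfolding eigvals_def by (rule someI[of _ as]) (rule assms)
  then have "proots (\<Prod>a\<leftarrow>eigvals A. [:- a, 1:]) = proots (\<Prod>a\<leftarrow>as. [:- a, 1:])"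
    using assms by simp
  moreover have "proots (\<Prod>a\<leftarrow>bs. [:- a, 1:]) = mset bs" for bs :: "complex list"
  proof (induction bs)
    case (Cons b bs)
    have "(\<Prod>a\<leftarrow>bs. [:- a, 1:]) \<noteq> 0" by (auto simp: prod_list_zero_iff)
    then have "proots ([:- b, 1:] * (\<Prod>a\<leftarrow>bs. [:- a, 1:])) = {#b#} + mset bs"
      using Cons by (subst proots_mult) auto
    then show ?case by (simp del: mult_pCons_left)
  qed simp
  ultimately have "mset (eigvals A) = mset as" by simp
  then have "sum_mset (image_mset (\<lambda>a. eta (Re a)) (mset (eigvals A)))
      = sum_mset (image_mset (\<lambda>a. eta (Re a)) (mset as))" by simp
  then show ?thesis
    unfolding vN_entropy_def by (simp add: sum_mset_sum_list flip: mset_map)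
qed

text \<open>Similar matrices have equal characteristic polynomials, so the SOME in
  \<open>eigvals\<close> picks literally the same list for both. This yields unitary
  invariance.\<close>

lemma vN_entropy_similar: "similar_mat A B \<Longrightarrow> vN_entropy A = vN_entropy B"
  using char_poly_similar[of A B] by (simp add: vN_entropy_def eigvals_def)

text \<open>The matrix of basis vectors conjugates \<open>A\<close> to a diagonal matrix, whose
  characteristic polynomial factors visibly. Multiplicities need no separate treatment, since
  \<open>T\<close> counts vectors and not eigenvalues.\<close>

lemma vN_entropy_eigenbasis:
  assumes eb: "eigenbasis n A T v lam"
  shows "vN_entropy A = (\<Sum>t\<in>T. eta (lam t))"
proof -
  have A: "A \<in> carrier_mat n n" using eb by (simp add: eigenbasis_def)
  obtain h where h: "bij_betw h {..<n} T"
    using eigenbasis_finite[OF eb] eigenbasis_card[OF eb] ex_bij_betw_nat_finite[of T]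
    by (auto simp: atLeast0LessThan)
  have hT: "h k \<in> T" if "k < n" for k
    using h that by (auto simp: bij_betw_def)
  have hinj: "h k = h l \<longleftrightarrow> k = l" if "k < n" "l < n" for k l
    using h that by (auto simp: bij_betw_def inj_on_def)
  define V where "V = mat n n (\<lambda>(r, k). v (h k) r)"
  define W where "W = mat n n (\<lambda>(k, r). cnj (v (h k) r))"
  define D where "D = mat n n (\<lambda>(k, l). if k = l then complex_of_real (lam (h k)) else 0)"
  have VWD: "V \<in> carrier_mat n n" "W \<in> carrier_mat n n" "D \<in> carrier_mat n n"
    by (auto simp: V_def W_def D_def)
  have WV: "W * V = 1\<^sub>m n"
  proof (rule eq_matI)
    fix i j assume "i < dim_row (1\<^sub>m n)" "j < dim_col (1\<^sub>m n)"
    then have ij: "i < n" "j < n" by auto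
    then have "(W * V) $$ (i, j) = cip n (v (h i)) (v (h j))"
      by (simp add: W_def V_def scalar_prod_def cip_def atLeast0LessThan)
    also have "\<dots> = (if i = j then 1 else 0)"
      using eigenbasis_orthonormal[OF eb] ij hT hinj by (auto simp: orthonormal_def)
    finally show "(W * V) $$ (i, j) = 1\<^sub>m n $$ (i, j)"
      using ij by simp
  qed (auto simp: W_def V_def)
  have VW: "V * W = 1\<^sub>m n"
    by (rule mat_mult_left_right_inverse[OF VWD(2,1) WV])
  have "A * V = V * D"
  proof (rule eq_matI)
    fix i j assume "i < dim_row (V * D)" "j < dim_col (V * D)"
    then have ij: "i < n" "j < n" by (auto simp: V_def D_def)
    have "(A * V) $$ (i, j) = mat_app n A (v (h j)) i"
      using ij A by (simp add: V_def scalar_prod_def mat_app_def atLeast0LessThan)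
    also have "\<dots> = of_real (lam (h j)) * v (h j) i"
      using eb ij hT by (auto simp: eigenbasis_def)
    also have "\<dots> = (\<Sum>k<n. if k = j then v (h k) i * of_real (lam (h k)) else 0)"
      using ij by (simp add: mult.commute)
    also have "\<dots> = (V * D) $$ (i, j)"
      using ij by (simp add: V_def D_def scalar_prod_def atLeast0LessThan if_distrib cong: if_cong)
    finally show "(A * V) $$ (i, j) = (V * D) $$ (i, j)" .
  qed (use A in \<open>auto simp: V_def D_def\<close>)
  then have "A = V * D * W"
    using A VWD VW by (metis assoc_mult_mat right_mult_one_mat)
  then have sim: "similar_mat A D"
    using A VWD VW WV by (intro similar_matI[of A D V W n]) auto
  have "upper_triangular D"
    by (auto simp: D_def)
  then have "char_poly A = (\<Prod>a\<leftarrow>diag_mat D. [:- a, 1:])"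
    using char_poly_similar[OF sim] char_poly_upper_triangular[OF VWD(3)] by simp
  then have "vN_entropy A = (\<Sum>a\<leftarrow>diag_mat D. eta (Re a))"
    by (rule vN_entropy_char_poly)
  also have "\<dots> = (\<Sum>k<n. eta (lam (h k)))"
    by (simp add: diag_mat_def D_def interv_sum_list_conv_sum_set_nat atLeast0LessThan o_def)
  also have "\<dots> = (\<Sum>t\<in>T. eta (lam t))"
    by (rule sum.reindex_bij_betw[OF h])
  finally show ?thesis .
qed

section \<open>The function \<open>\<eta>\<close>\<close>

lemma eta_nonneg_eq: "0 \<le> x \<Longrightarrow> eta x = - x * log 2 x"
  by (simp add: eta_def)

lemma eta_0 [simp]: "eta 0 = 0"
  by (simp add: eta_def)

lemma eta_1 [simp]: "eta 1 = 0"
  by (simp add: eta_def)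

lemma eta_mult: "0 \<le> a \<Longrightarrow> 0 \<le> b \<Longrightarrow> eta (a * b) = a * eta b + b * eta a"
  by (cases "a = 0 \<or> b = 0") (auto simp: eta_nonneg_eq log_mult algebra_simps)

text \<open>The right-hand side is the tangent to \<eta> at \<open>x\<close>, evaluated at
  \<open>y\<close>; the inequality is ln t \<le> t - 1 with t = x / y. At x = 0 the slope is
  infinite, and the last premise covers that point.\<close>

lemma eta_le_tangent:
  assumes "0 \<le> y" "0 \<le> x" "x = 0 \<Longrightarrow> y = 0"
  shows "eta y \<le> - y * log 2 x + (x - y) / ln 2"
proof (cases "y = 0")
  case True
  then show ?thesis using assms by simp
next
  case False
  then have y: "y > 0" and x: "x > 0" using assms by (auto simp: less_le)
  have "y * ln (x / y) \<le> y * (x / y - 1)"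
    using x y by (intro mult_left_mono ln_le_minus_one) auto
  also have "\<dots> = x - y" using y by (simp add: field_simps)
  finally have "y * ln (x / y) / ln 2 \<le> (x - y) / ln 2"
    by (intro divide_right_mono) auto
  moreover have "y * ln (x / y) / ln 2 = y * log 2 x - y * log 2 y"
    using x y by (simp add: ln_div log_def field_simps)
  ultimately show ?thesis using y by (simp add: eta_nonneg_eq)
qed

text \<open>The tangent at 1 gives a crude constant; what counts is that it is uniform in
  \<open>x\<close>, so that entropies are bounded by the dimension.\<close>

lemma eta_le: "eta x \<le> 1 / ln 2"
proof (cases "x \<le> 0")
  case False
  then have "eta x \<le> (1 - x) / ln 2" using eta_le_tangent[of x 1] by simp
  also have "\<dots> \<le> 1 / ln 2" using False by (intro divide_right_mono) auto
  finally show ?thesis .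
qed (simp add: eta_def)

text \<open>The tangent at the mean \<open>x\<close> dominates every \<open>eta (y k)\<close>, and
  its linear part averages out. A zero mean, where there is no tangent, forces all terms to
  vanish.\<close>

lemma eta_jensen:
  assumes K: "finite K" and w: "\<And>k. k \<in> K \<Longrightarrow> 0 \<le> w k" "(\<Sum>k\<in>K. w k) = 1"
    and y: "\<And>k. k \<in> K \<Longrightarrow> 0 \<le> y k"
  shows "(\<Sum>k\<in>K. w k * eta (y k)) \<le> eta (\<Sum>k\<in>K. w k * y k)"
proof -
  define x where "x = (\<Sum>k\<in>K. w k * y k)"
  have x0: "0 \<le> x" unfolding x_def using w y by (intro sum_nonneg) auto
  show ?thesis
  proof (cases "x = 0")
    case True
    then have "w k * y k = 0" if "k \<in> K" for k
      using that sum_nonneg_eq_0_iff[OF K, of "\<lambda>k. w k * y k"] w y unfolding x_def by auto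
    then have "w k * eta (y k) = 0" if "k \<in> K" for k
      using that by fastforce
    then show ?thesis using True by (simp flip: x_def)
  next
    case False
    have "(\<Sum>k\<in>K. w k * eta (y k)) \<le> (\<Sum>k\<in>K. w k * (- y k * log 2 x + (x - y k) / ln 2))"
      using w y x0 False by (intro sum_mono mult_left_mono eta_le_tangent) auto
    also have "\<dots> = (\<Sum>k\<in>K. - (w k * y k) * log 2 x + (w k * x - w k * y k) / ln 2)"
      by (intro sum.cong refl) (simp add: algebra_simps diff_divide_distrib)
    also have "\<dots> = - x * log 2 x + ((\<Sum>k\<in>K. w k) * x - x) / ln 2"
      by (simp add: sum.distrib x_def sum_distrib_right sum_subtractf sum_negf flip: sum_divide_distrib)
    also have "\<dots> = eta x" using w x0 by (simp add: eta_nonneg_eq)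
    finally show ?thesis by (simp add: x_def)
  qed
qed

text \<open>Gibbs' inequality compares each row \<open>s g\<close> with the column sums, rescaled to the mass of the
  row.\<close>

lemma eta_gap_superadditive:
  fixes s :: "'g \<Rightarrow> 'k \<Rightarrow> real"
  assumes G: "finite G" and K: "finite K" and s: "\<And>g k. g \<in> G \<Longrightarrow> k \<in> K \<Longrightarrow> 0 \<le> s g k"
  shows "(\<Sum>g\<in>G. (\<Sum>k\<in>K. eta (s g k)) - eta (\<Sum>k\<in>K. s g k))
           \<le> (\<Sum>k\<in>K. eta (\<Sum>g\<in>G. s g k)) - eta (\<Sum>k\<in>K. \<Sum>g\<in>G. s g k)"
proof -
  define c where "c = (\<lambda>k. \<Sum>g\<in>G. s g k)"
  define z where "z = (\<Sum>k\<in>K. c k)"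
  define a where "a = (\<lambda>g. \<Sum>k\<in>K. s g k)"
  have c0: "0 \<le> c k" if "k \<in> K" for k unfolding c_def using s that by (intro sum_nonneg) auto
  have a0: "0 \<le> a g" if "g \<in> G" for g unfolding a_def using s that by (intro sum_nonneg) auto
  have z0: "0 \<le> z" unfolding z_def using c0 by (intro sum_nonneg) auto
  have z': "z = (\<Sum>g\<in>G. a g)" unfolding z_def c_def a_def by (rule sum.swap)
  have sc: "s g k \<le> c k" if "g \<in> G" "k \<in> K" for g k
    unfolding c_def using s that by (intro member_le_sum G) auto
  have sa: "s g k \<le> a g" if "g \<in> G" "k \<in> K" for g k
    unfolding a_def using s that by (intro member_le_sum K) auto
  have cz: "c k \<le> z" if "k \<in> K" for k
    unfolding z_def using c0 that by (intro member_le_sum K) auto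
  have row: "(\<Sum>k\<in>K. eta (s g k)) - eta (a g) \<le> a g * log 2 z - (\<Sum>k\<in>K. s g k * log 2 (c k))"
    if g: "g \<in> G" for g
  proof -
    have "eta (s g k) \<le> - s g k * (log 2 (a g) + log 2 (c k) - log 2 z) + (a g * c k / z - s g k) / ln 2"
      if k: "k \<in> K" for k
    proof (cases "s g k = 0")
      case True
      then show ?thesis using a0[OF g] c0[OF k] z0 by simp
    next
      case False
      then have pos: "a g > 0" "c k > 0" "z > 0"
        using sa[OF g k] sc[OF g k] cz[OF k] s[OF g k] by linarith+
      then have "eta (s g k) \<le> - s g k * log 2 (a g * c k / z) + (a g * c k / z - s g k) / ln 2"
        using s[OF g k] by (intro eta_le_tangent) auto
      also have "log 2 (a g * c k / z) = log 2 (a g) + log 2 (c k) - log 2 z"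
        using pos by (simp add: log_mult log_divide)
      finally show ?thesis .
    qed
    then have "(\<Sum>k\<in>K. eta (s g k))
        \<le> (\<Sum>k\<in>K. - s g k * (log 2 (a g) + log 2 (c k) - log 2 z) + (a g * c k / z - s g k) / ln 2)"
      by (rule sum_mono)
    also have "\<dots> = (\<Sum>k\<in>K. (a g * c k / z - s g k) / ln 2 - s g k * log 2 (a g) + s g k * log 2 z
        - s g k * log 2 (c k))"
      by (intro sum.cong refl) (simp add: algebra_simps)
    also have "\<dots> = (a g * z / z - a g) / ln 2 - a g * log 2 (a g) + a g * log 2 z
        - (\<Sum>k\<in>K. s g k * log 2 (c k))"
      by (simp add: sum.distrib sum_subtractf a_def z_def flip: sum_divide_distrib sum_distrib_left
          sum_distrib_right)
    \<comment> \<open>Division by zero yields 0, so for \<open>z = 0\<close> the equation rests on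
      \<open>a g\<close> being a nonnegative summand of \<open>z\<close>.\<close>
    also have "a g * z / z = a g"
    proof (cases "z = 0")
      case True
      then have "a g = 0"
        using z' a0 g sum_nonneg_eq_0_iff[OF G, of a] by auto
      then show ?thesis by simp
    qed simp
    finally show ?thesis
      using a0[OF g] by (simp add: eta_nonneg_eq)
  qed
  have "(\<Sum>g\<in>G. (\<Sum>k\<in>K. eta (s g k)) - eta (a g))
      \<le> (\<Sum>g\<in>G. a g * log 2 z - (\<Sum>k\<in>K. s g k * log 2 (c k)))"
    by (rule sum_mono) (rule row)
  also have "\<dots> = z * log 2 z - (\<Sum>k\<in>K. c k * log 2 (c k))"
    by (simp add: sum_subtractf z' c_def sum_distrib_right) (rule sum.swap)
  also have "\<dots> = (\<Sum>k\<in>K. eta (c k)) - eta z"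
    using c0 z0 by (simp add: eta_nonneg_eq sum_negf)
  finally show ?thesis by (simp add: a_def c_def z_def)
qed

text \<open>As \<open>s k \<le> S\<close>, replacing \<open>log 2 (s k)\<close> by
  \<open>log 2 S\<close> can only lower a term, and the lowered terms add up to
  \<open>eta S\<close>. Applied to eigenvalues this makes the entropy gap nonnegative.\<close>

lemma eta_sum_le:
  fixes s :: "'k \<Rightarrow> real"
  assumes K: "finite K" and s: "\<And>k. k \<in> K \<Longrightarrow> 0 \<le> s k"
  shows "eta (\<Sum>k\<in>K. s k) \<le> (\<Sum>k\<in>K. eta (s k))"
proof -
  define S where "S = (\<Sum>k\<in>K. s k)"
  have S: "0 \<le> S" unfolding S_def using s by (rule sum_nonneg)
  have "- s k * log 2 S \<le> eta (s k)" if k: "k \<in> K" for k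
  proof (cases "s k = 0")
    case False
    have "s k \<le> S" unfolding S_def using s k by (intro member_le_sum K) auto
    moreover have "0 < s k" using False s[OF k] by simp
    ultimately show ?thesis by (simp add: eta_nonneg_eq)
  qed simp
  then have "(\<Sum>k\<in>K. - s k * log 2 S) \<le> (\<Sum>k\<in>K. eta (s k))"
    by (rule sum_mono)
  also have "(\<Sum>k\<in>K. - s k * log 2 S) = eta S"
    using S by (simp add: eta_nonneg_eq sum_negf S_def flip: sum_distrib_right)
  finally show ?thesis by (simp add: S_def)
qed

section \<open>Von Neumann entropy\<close>

definition qform :: "nat \<Rightarrow> complex mat \<Rightarrow> (nat \<Rightarrow> complex) \<Rightarrow> real" where
  "qform n A x = Re (cip n x (mat_app n A x))"

definition psd :: "nat \<Rightarrow> complex mat \<Rightarrow> bool" where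
  "psd n A \<longleftrightarrow> hermitian n A \<and> (\<forall>x. 0 \<le> qform n A x)"

definition re_trace :: "nat \<Rightarrow> complex mat \<Rightarrow> real" where
  "re_trace n A = (\<Sum>r<n. Re (A $$ (r, r)))"

lemma cip_mat_app: "cip n x (mat_app n A x) = (\<Sum>r<n. \<Sum>s<n. A $$ (r, s) * (x s * cnj (x r)))"
  by (simp add: cip_def mat_app_def sum_distrib_left algebra_simps)

section \<open>Quadratic forms and traces in orthonormal bases\<close>

lemma parseval:
  assumes on: "orthonormal n T v" and card: "card T = n"
  shows "(\<Sum>t\<in>T. (cmod (cip n (v t) x))\<^sup>2) = (\<Sum>r<n. (cmod (x r))\<^sup>2)"
proof -
  have "(\<Sum>t\<in>T. cnj (cip n (v t) x) * cip n (v t) x)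
      = (\<Sum>t\<in>T. \<Sum>r<n. \<Sum>s<n. cnj (x r) * x s * (v t r * cnj (v t s)))"
    unfolding cip_def cnj_sum sum_product by (intro sum.cong refl) simp
  also have "\<dots> = (\<Sum>r<n. \<Sum>s<n. cnj (x r) * x s * (\<Sum>t\<in>T. v t r * cnj (v t s)))"
    unfolding sum_distrib_left by (subst sum.swap, intro sum.cong refl, rule sum.swap)
  also have "\<dots> = (\<Sum>r<n. \<Sum>s<n. if s = r then cnj (x r) * x s else 0)"
    by (intro sum.cong refl) (auto simp: orthonormal_complete[OF on card])
  also have "\<dots> = cip n x x"
    by (simp add: cip_def)
  finally have "complex_of_real (\<Sum>t\<in>T. (cmod (cip n (v t) x))\<^sup>2) = of_real (\<Sum>r<n. (cmod (x r))\<^sup>2)"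
    unfolding cip_self by (simp add: complex_norm_square mult.commute del: of_real_power)
  then show ?thesis by (simp only: of_real_eq_iff)
qed

lemma orthonormal_norm:
  assumes "orthonormal n T v" "t \<in> T"
  shows "(\<Sum>r<n. (cmod (v t r))\<^sup>2) = 1"
proof -
  have "complex_of_real (\<Sum>r<n. (cmod (v t r))\<^sup>2) = 1"
    using assms by (simp only: cip_self[symmetric]) (simp add: orthonormal_def)
  then show ?thesis by (simp only: of_real_eq_1_iff)
qed

lemma qform_eigenvector:
  assumes eb: "eigenbasis n A T v lam" and t: "t \<in> T"
  shows "qform n A (v t) = lam t"
proof -
  have "cip n (v t) (mat_app n A (v t)) = of_real (lam t) * cip n (v t) (v t)"
    by (subst cip_scale_right[symmetric]) (use eb t in \<open>auto intro: cip_cong simp: eigenbasis_def\<close>)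
  also have "cip n (v t) (v t) = 1"
    using eigenbasis_orthonormal[OF eb] t by (simp add: orthonormal_def)
  finally show ?thesis by (simp add: qform_def)
qed

lemma qform_spectral:
  assumes eb: "eigenbasis n A T v lam"
  shows "qform n A x = (\<Sum>t\<in>T. (cmod (cip n (v t) x))\<^sup>2 * lam t)"
proof -
  have "cip n x (mat_app n A x)
      = (\<Sum>r<n. \<Sum>s<n. (\<Sum>t\<in>T. of_real (lam t) * v t r * cnj (v t s)) * (x s * cnj (x r)))"
    unfolding cip_mat_app by (intro sum.cong refl) (simp add: eigenbasis_spectral[OF eb])
  also have "\<dots> = (\<Sum>r<n. \<Sum>s<n. \<Sum>t\<in>T. of_real (lam t) * ((cnj (v t s) * x s) * (v t r * cnj (x r))))"
    by (simp add: sum_distrib_left sum_distrib_right mult_ac)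
  also have "\<dots> = (\<Sum>t\<in>T. \<Sum>r<n. \<Sum>s<n. of_real (lam t) * ((cnj (v t s) * x s) * (v t r * cnj (x r))))"
    by (subst (2) sum.swap, intro sum.cong refl, rule sum.swap)
  also have "\<dots> = (\<Sum>t\<in>T. of_real (lam t) * (cip n (v t) x * cnj (cip n (v t) x)))"
    unfolding cip_def cnj_sum sum_product unfolding sum_distrib_left
    by (rule sum.cong[OF refl], subst sum.swap) simp
  also have "\<dots> = of_real (\<Sum>t\<in>T. (cmod (cip n (v t) x))\<^sup>2 * lam t)"
    by (simp add: complex_norm_square mult.commute del: of_real_power)
  finally show ?thesis by (simp add: qform_def)
qed

lemma re_trace_orthonormal:
  assumes on: "orthonormal n T v" and card: "card T = n"
  shows "re_trace n A = (\<Sum>t\<in>T. qform n A (v t))"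
proof -
  have "(\<Sum>t\<in>T. cip n (v t) (mat_app n A (v t)))
      = (\<Sum>r<n. \<Sum>s<n. A $$ (r, s) * (\<Sum>t\<in>T. v t s * cnj (v t r)))"
    unfolding sum_distrib_left cip_mat_app
    by (subst sum.swap, intro sum.cong refl, rule sum.swap)
  also have "\<dots> = (\<Sum>r<n. \<Sum>s<n. if s = r then A $$ (r, s) else 0)"
    by (intro sum.cong refl) (auto simp: orthonormal_complete[OF on card])
  also have "\<dots> = (\<Sum>r<n. A $$ (r, r))" by simp
  finally show ?thesis
    by (simp add: qform_def re_trace_def flip: Re_sum)
qed

text \<open>The squared overlaps of the two bases form a doubly stochastic matrix that sends the
  spectrum to the diagonal in the basis \<open>e\<close>. Summing to 1 over \<open>t\<close>
  provides the Jensen weights; summing to 1 over \<open>k\<close> lets the entropy be rewritten as a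
  sum over \<open>K\<close>.\<close>

lemma vN_entropy_le_diagonal:
  assumes A: "psd n A" and on: "orthonormal n K e" and card: "card K = n"
  shows "vN_entropy A \<le> (\<Sum>k\<in>K. eta (qform n A (e k)))"
proof -
  obtain v lam where eb: "eigenbasis n A {..<n} v lam"
    using A unfolding psd_def by (metis hermitian_eigenbasis)
  have lam: "0 \<le> lam t" if "t < n" for t
    using qform_eigenvector[OF eb] A that by (metis lessThan_iff psd_def)
  define p where "p = (\<lambda>k t. (cmod (cip n (v t) (e k)))\<^sup>2)"
  have p1: "(\<Sum>t<n. p k t) = 1" if "k \<in> K" for k
    using parseval[OF eigenbasis_orthonormal[OF eb]] orthonormal_norm[OF on that] by (simp add: p_def)
  have p2: "(\<Sum>k\<in>K. p k t) = 1" if "t < n" for t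
  proof -
    have "(\<Sum>k\<in>K. p k t) = (\<Sum>k\<in>K. (cmod (cip n (e k) (v t)))\<^sup>2)"
      unfolding p_def by (subst cip_commute) simp
    then show ?thesis
      using parseval[OF on card, of "v t"] orthonormal_norm[OF eigenbasis_orthonormal[OF eb]] that by simp
  qed
  have "vN_entropy A = (\<Sum>t<n. (\<Sum>k\<in>K. p k t) * eta (lam t))"
    using p2 vN_entropy_eigenbasis[OF eb] by simp
  also have "\<dots> = (\<Sum>k\<in>K. \<Sum>t<n. p k t * eta (lam t))"
    unfolding sum_distrib_right by (rule sum.swap)
  also have "\<dots> \<le> (\<Sum>k\<in>K. eta (\<Sum>t<n. p k t * lam t))"
    using p1 lam by (intro sum_mono eta_jensen) (auto simp: p_def)
  also have "\<dots> = (\<Sum>k\<in>K. eta (qform n A (e k)))"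
    by (simp add: qform_spectral[OF eb] p_def)
  finally show ?thesis .
qed

text \<open>In the eigenbasis of \<open>B\<close> the diagonal bound is an equality for
  \<open>B\<close> and points the right way for each \<open>A g\<close>, while traces do not depend
  on the basis. What remains is \<open>eta_gap_superadditive\<close> for the diagonal
  entries.\<close>

lemma vN_entropy_gap_superadditive:
  assumes G: "finite G" and A: "\<And>g. g \<in> G \<Longrightarrow> psd n (A g)" and B: "hermitian n B"
    and sum: "\<And>r s. r < n \<Longrightarrow> s < n \<Longrightarrow> B $$ (r, s) = (\<Sum>g\<in>G. A g $$ (r, s))"
  shows "(\<Sum>g\<in>G. vN_entropy (A g) - eta (re_trace n (A g))) \<le> vN_entropy B - eta (re_trace n B)"
proof -
  obtain v lam where eb: "eigenbasis n B {..<n} v lam"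
    by (rule hermitian_eigenbasis[OF B])
  note on = eigenbasis_orthonormal[OF eb] and cd = eigenbasis_card[OF eb]
  have q: "qform n B x = (\<Sum>g\<in>G. qform n (A g) x)" for x
  proof -
    have "cip n x (mat_app n B x) = (\<Sum>r<n. \<Sum>s<n. \<Sum>g\<in>G. A g $$ (r, s) * (x s * cnj (x r)))"
      unfolding cip_mat_app by (intro sum.cong refl) (simp add: sum sum_distrib_right)
    also have "\<dots> = (\<Sum>g\<in>G. \<Sum>r<n. \<Sum>s<n. A g $$ (r, s) * (x s * cnj (x r)))"
      by (subst (2) sum.swap, intro sum.cong refl, rule sum.swap)
    finally show ?thesis by (simp add: qform_def cip_mat_app)
  qed
  have "(\<Sum>g\<in>G. vN_entropy (A g) - eta (re_trace n (A g)))
      \<le> (\<Sum>g\<in>G. (\<Sum>k<n. eta (qform n (A g) (v k))) - eta (\<Sum>k<n. qform n (A g) (v k)))"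
    using vN_entropy_le_diagonal[OF A on cd] by (intro sum_mono) (simp add: re_trace_orthonormal[OF on cd])
  also have "\<dots> \<le> (\<Sum>k<n. eta (qform n B (v k))) - eta (\<Sum>k<n. qform n B (v k))"
    unfolding q using A by (intro eta_gap_superadditive G) (auto simp: psd_def)
  also have "(\<Sum>k<n. eta (qform n B (v k))) = vN_entropy B"
    using vN_entropy_eigenbasis[OF eb] by (simp add: qform_eigenvector[OF eb])
  finally show ?thesis by (simp add: re_trace_orthonormal[OF on cd])
qed

lemma eta_trace_le_vN_entropy:
  assumes A: "psd n A"
  shows "eta (re_trace n A) \<le> vN_entropy A"
proof -
  obtain v lam where eb: "eigenbasis n A {..<n} v lam"
    using A unfolding psd_def by (metis hermitian_eigenbasis)
  have "eta (\<Sum>t<n. qform n A (v t)) \<le> (\<Sum>t<n. eta (qform n A (v t)))"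
    using A by (intro eta_sum_le) (auto simp: psd_def)
  then show ?thesis
    using re_trace_orthonormal[OF eigenbasis_orthonormal[OF eb] eigenbasis_card[OF eb]]
      vN_entropy_eigenbasis[OF eb] by (simp add: qform_eigenvector[OF eb])
qed

lemma vN_entropy_le_dim:
  assumes A: "hermitian n A"
  shows "vN_entropy A \<le> real n / ln 2"
proof -
  obtain v lam where eb: "eigenbasis n A {..<n} v lam"
    by (rule hermitian_eigenbasis[OF A])
  have "(\<Sum>t<n. eta (lam t)) \<le> (\<Sum>t<n. 1 / ln 2)"
    by (intro sum_mono eta_le)
  then show ?thesis
    using vN_entropy_eigenbasis[OF eb] by simp
qed

text \<open>Eigenvectors of the blocks, extended by zero, form an eigenbasis of \<open>M\<close>.
  The bijection is abstract because the blocks are labelled by \<open>j\<close> for BC but by the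
  pair (i, j) for ABC, and in neither case are their indices contiguous in general.\<close>

lemma vN_entropy_block:
  fixes blk :: "nat \<Rightarrow> 'l" and pos :: "nat \<Rightarrow> nat"
  assumes L: "finite L" and M: "M \<in> carrier_mat N N"
    and bij: "bij_betw (\<lambda>r. (blk r, pos r)) {..<N} (L \<times> {..<d})"
    and X: "\<And>l. l \<in> L \<Longrightarrow> hermitian d (X l)"
    and ent: "\<And>r s. r < N \<Longrightarrow> s < N \<Longrightarrow>
       M $$ (r, s) = (if blk r = blk s then X (blk r) $$ (pos r, pos s) else 0)"
  shows "vN_entropy M = (\<Sum>l\<in>L. vN_entropy (X l))"
proof -
  have "\<forall>l. \<exists>v lam. l \<in> L \<longrightarrow> eigenbasis d (X l) {..<d} v lam"
    using X hermitian_eigenbasis by metis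
  then obtain v lam where eb: "\<And>l. l \<in> L \<Longrightarrow> eigenbasis d (X l) {..<d} (v l) (lam l)"
    by metis
  have reix: "(\<Sum>r<N. f (blk r) (pos r)) = (\<Sum>l\<in>L. \<Sum>k<d. f l k)" for f :: "'l \<Rightarrow> nat \<Rightarrow> complex"
    using sum.reindex_bij_betw[OF bij, of "\<lambda>(l, k). f l k"] by (simp add: sum.cartesian_product)
  have blkpos: "blk r \<in> L" "pos r < d" if "r < N" for r
    using bij that by (auto simp: bij_betw_def)
  define w where "w = (\<lambda>(l, t) r. if blk r = l then v l t (pos r) else 0)"
  define mu where "mu = (\<lambda>(l, t). lam l t)"
  have "card {..<N} = card (L \<times> {..<d})"
    by (rule bij_betw_same_card[OF bij])
  then have card: "card (L \<times> {..<d}) = N" by simp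
  have on: "orthonormal N (L \<times> {..<d}) w"
    unfolding orthonormal_def
  proof (intro conjI ballI)
    show "finite (L \<times> {..<d})" using L by simp
    fix a b assume "a \<in> L \<times> {..<d}" "b \<in> L \<times> {..<d}"
    then obtain l t m u where ab: "a = (l, t)" "b = (m, u)" "l \<in> L" "m \<in> L" "t < d" "u < d" by auto
    have "cip N (w a) (w b) = (\<Sum>r<N. if blk r = l then if blk r = m then cnj (v l t (pos r)) * v m u (pos r) else 0 else 0)"
      unfolding cip_def ab w_def by (intro sum.cong refl) auto
    also have "\<dots> = (\<Sum>j\<in>L. \<Sum>k<d. if j = l then if j = m then cnj (v l t k) * v m u k else 0 else 0)"
      by (rule reix)
    also have "\<dots> = (\<Sum>j\<in>L. if j = l then if l = m then cip d (v l t) (v m u) else 0 else 0)"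
      by (intro sum.cong refl) (auto simp: cip_def)
    also have "\<dots> = (if l = m then cip d (v l t) (v m u) else 0)"
      using L ab by simp
    also have "\<dots> = (if a = b then 1 else 0)"
      using eigenbasis_orthonormal[OF eb[OF ab(3)]] ab by (auto simp: orthonormal_def)
    finally show "cip N (w a) (w b) = (if a = b then 1 else 0)" .
  qed
  have "mat_app N M (w a) r = of_real (mu a) * w a r"
    if aL: "a \<in> L \<times> {..<d}" and rN: "r < N" for a r
  proof -
    obtain l t where a: "a = (l, t)" "l \<in> L" "t < d" using aL by auto
    have "mat_app N M (w a) r
        = (\<Sum>s<N. if blk s = l then if blk r = l then X l $$ (pos r, pos s) * v l t (pos s) else 0 else 0)"
      unfolding mat_app_def a w_def using rN by (intro sum.cong refl) (auto simp: ent)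
    also have "\<dots> = (\<Sum>j\<in>L. \<Sum>k<d. if j = l then if blk r = l then X l $$ (pos r, k) * v l t k else 0 else 0)"
      by (rule reix)
    also have "\<dots> = (\<Sum>j\<in>L. if j = l then if blk r = l then mat_app d (X l) (v l t) (pos r) else 0 else 0)"
      by (intro sum.cong refl) (auto simp: mat_app_def)
    also have "\<dots> = (if blk r = l then mat_app d (X l) (v l t) (pos r) else 0)"
      using L a by simp
    also have "\<dots> = of_real (mu a) * w a r"
      using eb[OF a(2)] a blkpos[OF rN] by (auto simp: eigenbasis_def mu_def w_def)
    finally show ?thesis .
  qed
  then have "eigenbasis N M (L \<times> {..<d}) w mu"
    using on card M by (simp add: eigenbasis_def)
  then have "vN_entropy M = (\<Sum>a\<in>L \<times> {..<d}. eta (mu a))"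
    by (rule vN_entropy_eigenbasis)
  also have "\<dots> = (\<Sum>l\<in>L. \<Sum>t<d. eta (lam l t))"
    by (simp add: mu_def sum.cartesian_product split_def)
  also have "\<dots> = (\<Sum>l\<in>L. vN_entropy (X l))"
    by (intro sum.cong refl) (simp add: vN_entropy_eigenbasis[OF eb])
  finally show ?thesis .
qed

lemma vN_entropy_diagonal:
  assumes M: "M \<in> carrier_mat n n"
    and ent: "\<And>r s. r < n \<Longrightarrow> s < n \<Longrightarrow> M $$ (r, s) = (if r = s then of_real (a r) else 0)"
  shows "vN_entropy M = (\<Sum>r<n. eta (a r))"
proof (rule vN_entropy_eigenbasis)
  show "eigenbasis n M {..<n} (\<lambda>t r. if r = t then 1 else 0) a"
    using M by (auto simp: eigenbasis_def orthonormal_def cip_def mat_app_def ent if_distrib cong: if_cong)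
qed

text \<open>Every eigenvalue is 0 or \<open>w\<close> and they add up to the trace \<open>w\<close>,
  so the entropy is determined without finding out which eigenvector is parallel to
  \<open>phi\<close>.\<close>

lemma vN_entropy_rank_one:
  assumes w: "0 \<le> w" and phi: "phi \<in> carrier_vec d" "(\<Sum>k<d. (cmod (phi $ k))\<^sup>2) = 1"
    and X: "X \<in> carrier_mat d d"
    and ent: "\<And>k l. k < d \<Longrightarrow> l < d \<Longrightarrow> X $$ (k, l) = of_real w * (phi $ k * cnj (phi $ l))"
  shows "vN_entropy X = eta w"
proof -
  have "hermitian d X" using X by (auto simp: hermitian_def ent)
  then obtain v lam where eb: "eigenbasis d X {..<d} v lam"
    by (rule hermitian_eigenbasis)
  have app: "mat_app d X x k = of_real w * cip d (($) phi) x * phi $ k" if "k < d" for x k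
    using that by (simp add: mat_app_def ent cip_def sum_distrib_left sum_distrib_right algebra_simps)
  have pp: "cip d (($) phi) (($) phi) = 1"
    unfolding cip_self using phi by simp
  have tr: "(\<Sum>t<d. lam t) = w"
  proof -
    have "(\<Sum>t<d. lam t) = re_trace d X"
      using re_trace_orthonormal[OF eigenbasis_orthonormal[OF eb] eigenbasis_card[OF eb]]
      by (simp add: qform_eigenvector[OF eb])
    also have "\<dots> = (\<Sum>k<d. w * (cmod (phi $ k))\<^sup>2)"
      unfolding re_trace_def by (intro sum.cong refl) (simp add: ent complex_mult_cnj cmod_power2)
    also have "\<dots> = w"
      using phi by (simp flip: sum_distrib_left)
    finally show ?thesis .
  qed
  have lam: "lam t = 0 \<or> lam t = w" if t: "t < d" for t
  proof (cases "cip d (($) phi) (v t) = 0")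
    case True
    have "lam t = qform d X (v t)" using qform_eigenvector[OF eb] t by simp
    also have "\<dots> = 0"
      unfolding qform_def cip_def using True by (simp add: app)
    finally show ?thesis by simp
  next
    case False
    have "of_real (lam t) * cip d (($) phi) (v t) = cip d (($) phi) (mat_app d X (v t))"
      by (subst cip_scale_right[symmetric]) (use eb t in \<open>auto intro: cip_cong simp: eigenbasis_def\<close>)
    also have "\<dots> = of_real w * cip d (($) phi) (v t) * cip d (($) phi) (($) phi)"
      by (subst cip_scale_right[symmetric]) (auto intro: cip_cong simp: app)
    finally show ?thesis
      using False by (simp add: pp)
  qed
  \<comment> \<open>On the two possible values of \<open>lam t\<close> the function \<eta> agrees
    with a linear one, so the trace alone evaluates the sum. After cancelling \<open>w\<close>, the
    case \<open>w = 0\<close> is separate: all eigenvalues vanish.\<close>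
  have "w * eta (lam t) = lam t * eta w" if "t < d" for t
    using lam[OF that] by auto
  then have "w * (\<Sum>t<d. eta (lam t)) = w * eta w"
    by (simp add: sum_distrib_left flip: tr) (simp flip: sum_distrib_right tr)
  then have "(\<Sum>t<d. eta (lam t)) = eta w"
    using lam by (cases "w = 0") auto
  then show ?thesis
    using vN_entropy_eigenbasis[OF eb] by simp
qed

section \<open>Ensembles of pure states\<close>

lemma bij_betw_div_mod:
  "bij_betw (\<lambda>r. (r div m, r mod m)) {..<a * m} ({..<a} \<times> {..<m :: nat})"
proof (rule bij_betw_byWitness[where f' = "\<lambda>(x, z). x * m + z"])
  show "(\<lambda>r. (r div m, r mod m)) ` {..<a * m} \<subseteq> {..<a} \<times> {..<m}"
    by (cases "m = 0") (auto simp: less_mult_imp_div_less)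
  have "x * m + z < a * m" if "x < a" "z < m" for x z
  proof -
    have "x * m + z < Suc x * m" using that by simp
    also have "\<dots> \<le> a * m" using that by (intro mult_le_mono) auto
    finally show ?thesis .
  qed
  then show "(\<lambda>(x, z). x * m + z) ` ({..<a} \<times> {..<m}) \<subseteq> {..<a * m}"
    by auto
qed auto

lemma sum_div_mod: "(\<Sum>r<a * m. f (r div m) (r mod m)) = (\<Sum>x<a. \<Sum>z<m. f x z)" for m :: nat
  using sum.reindex_bij_betw[OF bij_betw_div_mod, of "\<lambda>(x, z). f x z" m a]
  by (simp add: sum.cartesian_product)

lemma enc3_div_mod:
  assumes "x < a" "y < b" "z < c"
  shows "enc3 b c x y z div c = x * b + y" "enc3 b c x y z mod c = z"
    "enc3 b c x y z div (b * c) = x" "enc3 b c x y z div c mod b = y" "enc3 b c x y z < a * b * c"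
proof -
  show 1: "enc3 b c x y z div c = x * b + y" and "enc3 b c x y z mod c = z"
    using assms by (simp_all add: enc3_def)
  show "enc3 b c x y z div (b * c) = x"
    unfolding mult.commute[of b c] div_mult2_eq 1 using assms by simp
  show "enc3 b c x y z div c mod b = y"
    using 1 assms by simp
  have "x * b + y < Suc x * b" using assms by simp
  also have "\<dots> \<le> a * b" using assms by (intro mult_le_mono) auto
  finally have "x * b + y < a * b" .
  then have "Suc (x * b + y) * c \<le> a * b * c"
    by (intro mult_le_mono) auto
  then show "enc3 b c x y z < a * b * c"
    using assms by (simp add: enc3_def)
qed

text \<open>The classical indices of A and C are grouped as the block label and the quantum index of
  B is the position inside the block, as \<open>vN_entropy_block\<close> expects.\<close>

lemma bij_betw_enc3:
  "bij_betw (\<lambda>r. ((r div (b * c), r mod c), r div c mod b)) {..<a * b * c}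
     (({..<a} \<times> {..<c}) \<times> {..<b :: nat})"
proof (rule bij_betw_byWitness[where f' = "\<lambda>((x, z), y). enc3 b c x y z"], goal_cases)
  case 1
  show ?case
    by (simp add: enc3_def mult.commute[of b c] div_mult2_eq)
next
  case 3
  show ?case
    by (cases "b = 0 \<or> c = 0") (auto simp: less_mult_imp_div_less mult.assoc)
qed (auto simp: enc3_div_mod)

lemma sum_swap3: "(\<Sum>r\<in>A. \<Sum>s\<in>B. \<Sum>i\<in>C. f r s i) = (\<Sum>i\<in>C. \<Sum>r\<in>A. \<Sum>s\<in>B. f r s i)"
proof -
  have "(\<Sum>r\<in>A. \<Sum>s\<in>B. \<Sum>i\<in>C. f r s i) = (\<Sum>r\<in>A. \<Sum>i\<in>C. \<Sum>s\<in>B. f r s i)"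
    by (rule sum.cong[OF refl], rule sum.swap)
  also have "\<dots> = (\<Sum>i\<in>C. \<Sum>r\<in>A. \<Sum>s\<in>B. f r s i)"
    by (rule sum.swap)
  finally show ?thesis .
qed

lemma distrD:
  assumes "distr n p"
  shows "0 \<le> p i" "n \<le> i \<Longrightarrow> p i = 0" "(\<Sum>i<n. p i) = 1"
  using assms by (auto simp: distr_def)

text \<open>With \<open>w i = p i * K i j\<close> this is the unnormalised state of B on outcome
  \<open>j\<close>; its trace is the probability of that outcome.\<close>

definition ensemble :: "nat \<Rightarrow> nat \<Rightarrow> (nat \<Rightarrow> complex vec) \<Rightarrow> (nat \<Rightarrow> real) \<Rightarrow> complex mat" where
  "ensemble n d phi w = mat d d (\<lambda>(k, l). \<Sum>i<n. of_real (w i) * (phi i $ k * cnj (phi i $ l)))"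

text \<open>For nonnegative weights of total t > 0 this is t times the entropy of the normalised
  state. It is thus homogeneous of degree one, concavity takes the form of superadditivity, and
  outcomes of probability zero cause no division.\<close>

definition entropy_gap :: "nat \<Rightarrow> nat \<Rightarrow> (nat \<Rightarrow> complex vec) \<Rightarrow> (nat \<Rightarrow> real) \<Rightarrow> real" where
  "entropy_gap n d phi w = vN_entropy (ensemble n d phi w) - eta (\<Sum>i<n. w i)"

lemma entropy_gap_cong:
  assumes "\<And>i. i < n \<Longrightarrow> w i = w' i"
  shows "entropy_gap n d phi w = entropy_gap n d phi w'"
proof -
  have "ensemble n d phi w = ensemble n d phi w'"
    unfolding ensemble_def by (rule arg_cong[of _ _ "mat d d"]) (auto simp: assms)
  then show ?thesis
    using assms by (simp add: entropy_gap_def)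
qed

locale pure_states =
  fixes n d :: nat and phi :: "nat \<Rightarrow> complex vec"
  assumes states: "i < n \<Longrightarrow> phi i \<in> carrier_vec d \<and> (\<Sum>k<d. (cmod (phi i $ k))\<^sup>2) = 1"
begin

lemma norm_phi: "i < n \<Longrightarrow> (\<Sum>k<d. phi i $ k * cnj (phi i $ k)) = 1"
  using states[of i] by (simp add: complex_norm_square[symmetric] flip: of_real_sum of_real_power)

lemma proj_phi: "i < n \<Longrightarrow> k < d \<Longrightarrow> l < d \<Longrightarrow> proj (phi i) $$ (k, l) = phi i $ k * cnj (phi i $ l)"
  using states[of i] by (auto simp: proj_def dest!: carrier_vecD)

lemma hermitian_ensemble: "hermitian d (ensemble n d phi w)"
  unfolding hermitian_def by (auto simp: ensemble_def mult_ac intro!: sum.cong)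

lemma psd_ensemble:
  assumes w: "\<And>i. i < n \<Longrightarrow> 0 \<le> w i"
  shows "psd d (ensemble n d phi w)"
  unfolding psd_def
proof (intro conjI allI hermitian_ensemble)
  fix x
  have "cip d x (mat_app d (ensemble n d phi w) x)
      = (\<Sum>r<d. \<Sum>s<d. \<Sum>i<n. of_real (w i) * ((cnj (x r) * phi i $ r) * cnj (cnj (x s) * phi i $ s)))"
    unfolding cip_mat_app
    by (intro sum.cong refl) (simp add: ensemble_def sum_distrib_left sum_distrib_right mult_ac)
  also have "\<dots> = (\<Sum>i<n. \<Sum>r<d. \<Sum>s<d. of_real (w i) * ((cnj (x r) * phi i $ r) * cnj (cnj (x s) * phi i $ s)))"
    by (rule sum_swap3)
  also have "\<dots> = (\<Sum>i<n. of_real (w i) * (cip d x (($) (phi i)) * cnj (cip d x (($) (phi i)))))"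
    unfolding cip_def cnj_sum sum_product unfolding sum_distrib_left by simp
  also have "\<dots> = of_real (\<Sum>i<n. w i * (cmod (cip d x (($) (phi i))))\<^sup>2)"
    by (simp add: complex_norm_square del: of_real_power)
  finally have "qform d (ensemble n d phi w) x = (\<Sum>i<n. w i * (cmod (cip d x (($) (phi i))))\<^sup>2)"
    unfolding qform_def by (simp only: Re_complex_of_real)
  then show "0 \<le> qform d (ensemble n d phi w) x"
    using w by (auto intro!: sum_nonneg)
qed

lemma re_trace_ensemble: "re_trace d (ensemble n d phi w) = (\<Sum>i<n. w i)"
proof -
  have "(\<Sum>r<d. ensemble n d phi w $$ (r, r)) = (\<Sum>i<n. of_real (w i) * (\<Sum>r<d. phi i $ r * cnj (phi i $ r)))"
    unfolding sum_distrib_left by (subst sum.swap) (simp add: ensemble_def)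
  also have "\<dots> = of_real (\<Sum>i<n. w i)"
    by (simp add: norm_phi)
  finally have "Re (\<Sum>r<d. ensemble n d phi w $$ (r, r)) = (\<Sum>i<n. w i)"
    by (simp only: Re_complex_of_real)
  then show ?thesis
    by (simp add: re_trace_def)
qed

lemma entropy_gap_nonneg: "(\<And>i. i < n \<Longrightarrow> 0 \<le> w i) \<Longrightarrow> 0 \<le> entropy_gap n d phi w"
  using eta_trace_le_vN_entropy[OF psd_ensemble] by (simp add: entropy_gap_def re_trace_ensemble)

lemma entropy_gap_superadditive:
  assumes G: "finite G" and w: "\<And>g i. g \<in> G \<Longrightarrow> i < n \<Longrightarrow> 0 \<le> w g i"
  shows "(\<Sum>g\<in>G. entropy_gap n d phi (w g)) \<le> entropy_gap n d phi (\<lambda>i. \<Sum>g\<in>G. w g i)"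
proof -
  have "ensemble n d phi (\<lambda>i. \<Sum>g\<in>G. w g i) $$ (r, s) = (\<Sum>g\<in>G. ensemble n d phi (w g) $$ (r, s))"
    if "r < d" "s < d" for r s
    using that by (simp add: ensemble_def sum_distrib_right) (rule sum.swap)
  then show ?thesis
    using vN_entropy_gap_superadditive[OF G psd_ensemble hermitian_ensemble, of "\<lambda>g i. w g i"] w
    by (simp add: entropy_gap_def re_trace_ensemble)
qed

text \<open>Reindexing by \<pi> shows that the ensemble for \<open>w\<close> is the conjugate by
  \<open>V\<close> of the ensemble for the permuted weights; entropy is a similarity invariant, and
  the total weight is unchanged.\<close>

lemma entropy_gap_covariant:
  assumes \<pi>: "bij_betw \<pi> {..<n} {..<n}" and V: "unitary_mat d V"
    and cov: "\<And>i. i < n \<Longrightarrow> proj (phi (\<pi> i)) = V * proj (phi i) * mat_adjoint V"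
  shows "entropy_gap n d phi (\<lambda>i. w (\<pi> i)) = entropy_gap n d phi w"
proof -
  let ?W = "mat_adjoint V"
  have V': "V \<in> carrier_mat d d" "V * ?W = 1\<^sub>m d" "?W * V = 1\<^sub>m d"
    using V by (auto simp: unitary_mat_def)
  have W: "?W \<in> carrier_mat d d"
    using V' by (metis carrier_matI carrier_matD(1) carrier_matD(2) index_mult_mat(2,3) index_one_mat(2,3))
  have conj: "(V * X * ?W) $$ (k, l) = (\<Sum>b<d. \<Sum>a<d. V $$ (k, a) * X $$ (a, b) * ?W $$ (b, l))"
    if "X \<in> carrier_mat d d" "k < d" "l < d" for X k l
  proof -
    have "(V * X * ?W) $$ (k, l) = (\<Sum>a<d. V $$ (k, a) * (\<Sum>b<d. X $$ (a, b) * ?W $$ (b, l)))"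
      using that V' W by (simp add: scalar_prod_def atLeast0LessThan)
    then show ?thesis
      by (simp add: sum_distrib_left mult.assoc) (rule sum.swap)
  qed
  have pc: "proj (phi i) \<in> carrier_mat d d" if "i < n" for i
    using states[OF that] by (auto simp: proj_def)
  have \<pi>n: "\<pi> i < n" if "i < n" for i using \<pi> that by (auto simp: bij_betw_def)
  have "ensemble n d phi w = V * ensemble n d phi (\<lambda>i. w (\<pi> i)) * ?W"
  proof (rule eq_matI)
    fix k l assume "k < dim_row (V * ensemble n d phi (\<lambda>i. w (\<pi> i)) * ?W)"
      "l < dim_col (V * ensemble n d phi (\<lambda>i. w (\<pi> i)) * ?W)"
    then have kl: "k < d" "l < d" using V' W by auto
    have "ensemble n d phi w $$ (k, l) = (\<Sum>i<n. of_real (w i) * proj (phi i) $$ (k, l))"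
      using kl by (simp add: ensemble_def proj_phi)
    also have "\<dots> = (\<Sum>i<n. of_real (w (\<pi> i)) * proj (phi (\<pi> i)) $$ (k, l))"
      by (rule sum.reindex_bij_betw[OF \<pi>, symmetric])
    also have "\<dots> = (\<Sum>i<n. \<Sum>b<d. \<Sum>a<d. V $$ (k, a) * (of_real (w (\<pi> i)) * proj (phi i) $$ (a, b)) * ?W $$ (b, l))"
      using kl by (intro sum.cong refl) (simp add: cov conj pc sum_distrib_left mult_ac)
    also have "\<dots> = (\<Sum>b<d. \<Sum>a<d. \<Sum>i<n. V $$ (k, a) * (of_real (w (\<pi> i)) * proj (phi i) $$ (a, b)) * ?W $$ (b, l))"
      by (rule sum_swap3[symmetric])
    also have "\<dots> = (\<Sum>b<d. \<Sum>a<d. V $$ (k, a) * ensemble n d phi (\<lambda>i. w (\<pi> i)) $$ (a, b) * ?W $$ (b, l))"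
      by (intro sum.cong refl) (simp add: ensemble_def proj_phi sum_distrib_left sum_distrib_right)
    also have "\<dots> = (V * ensemble n d phi (\<lambda>i. w (\<pi> i)) * ?W) $$ (k, l)"
      using kl by (intro conj[symmetric]) (simp_all add: ensemble_def)
    finally show "ensemble n d phi w $$ (k, l) = (V * ensemble n d phi (\<lambda>i. w (\<pi> i)) * ?W) $$ (k, l)" .
  qed (use V' W in \<open>auto simp: ensemble_def\<close>)
  then have "similar_mat (ensemble n d phi w) (ensemble n d phi (\<lambda>i. w (\<pi> i)))"
    using V' W by (intro similar_matI[of _ _ V ?W d]) (auto simp: ensemble_def)
  then show ?thesis
    using sum.reindex_bij_betw[OF \<pi>, of w] by (simp add: entropy_gap_def vN_entropy_similar)
qed

section \<open>Entropies of \<open>rho_ABC\<close> and its marginals\<close>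

lemma rho_ABC_enc3:
  assumes "x < n" "y < d" "z < m" "x' < n" "y' < d" "z' < m"
  shows "rho_ABC n d phi p m K $$ (enc3 d m x y z, enc3 d m x' y' z')
    = (if x = x' \<and> z = z' then of_real (p x * K x z) * (phi x $ y * cnj (phi x $ y')) else 0)"
  using assms by (simp add: rho_ABC_def Let_def enc3_div_mod proj_phi)

lemma vN_entropy_red_A:
  assumes K: "cond_distr n m K"
  shows "vN_entropy (red_A n d m (rho_ABC n d phi p m K)) = (\<Sum>i<n. eta (p i))"
proof (rule vN_entropy_diagonal)
  fix r s assume rs: "r < n" "s < n"
  have "red_A n d m (rho_ABC n d phi p m K) $$ (r, s)
      = (\<Sum>y<d. \<Sum>z<m. if r = s then of_real (p r * K r z) * (phi r $ y * cnj (phi r $ y)) else 0)"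
    using rs by (simp add: red_A_def rho_ABC_enc3 cong: if_cong)
  also have "\<dots> = (if r = s then (\<Sum>y<d. phi r $ y * cnj (phi r $ y)) * of_real (\<Sum>z<m. p r * K r z) else 0)"
    unfolding of_real_sum sum_product by (simp add: mult_ac)
  also have "(\<Sum>z<m. p r * K r z) = p r"
    using K rs by (simp add: cond_distr_def distrD flip: sum_distrib_left)
  finally show "red_A n d m (rho_ABC n d phi p m K) $$ (r, s) = (if r = s then of_real (p r) else 0)"
    using rs by (simp add: norm_phi)
qed (simp add: red_A_def)

lemma vN_entropy_red_C:
  "vN_entropy (red_C n d m (rho_ABC n d phi p m K)) = (\<Sum>j<m. eta (\<Sum>i<n. p i * K i j))"
proof (rule vN_entropy_diagonal)
  fix r s assume rs: "r < m" "s < m"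
  have "red_C n d m (rho_ABC n d phi p m K) $$ (r, s)
      = (\<Sum>x<n. \<Sum>y<d. if r = s then of_real (p x * K x r) * (phi x $ y * cnj (phi x $ y)) else 0)"
    using rs by (simp add: red_C_def) (auto simp: rho_ABC_enc3 intro!: sum.cong)
  also have "\<dots> = (if r = s then (\<Sum>x<n. of_real (p x * K x r) * (\<Sum>y<d. phi x $ y * cnj (phi x $ y))) else 0)"
    by (simp add: sum_distrib_left)
  finally show "red_C n d m (rho_ABC n d phi p m K) $$ (r, s)
      = (if r = s then of_real (\<Sum>i<n. p i * K i r) else 0)"
    by (simp add: norm_phi)
qed (simp add: red_C_def)

lemma vN_entropy_red_AC:
  "vN_entropy (red_AC n d m (rho_ABC n d phi p m K)) = (\<Sum>i<n. \<Sum>j<m. eta (p i * K i j))"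
proof -
  have "vN_entropy (red_AC n d m (rho_ABC n d phi p m K))
      = (\<Sum>r<n * m. eta (p (r div m) * K (r div m) (r mod m)))"
  proof (rule vN_entropy_diagonal)
    fix r s assume rs: "r < n * m" "s < n * m"
    then have dm: "r div m < n" "s div m < n" "r mod m < m" "s mod m < m"
      by (auto simp: less_mult_imp_div_less intro!: mod_less_divisor intro: ccontr)
    have eq: "r div m = s div m \<and> r mod m = s mod m \<longleftrightarrow> r = s"
      by (metis div_mult_mod_eq)
    have "red_AC n d m (rho_ABC n d phi p m K) $$ (r, s)
        = (\<Sum>y<d. if r = s then of_real (p (r div m) * K (r div m) (r mod m))
            * (phi (r div m) $ y * cnj (phi (r div m) $ y)) else 0)"
      using rs dm by (simp add: red_AC_def) (auto simp: rho_ABC_enc3 eq intro!: sum.cong)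
    also have "\<dots> = (if r = s then of_real (p (r div m) * K (r div m) (r mod m))
            * (\<Sum>y<d. phi (r div m) $ y * cnj (phi (r div m) $ y)) else 0)"
      by (simp add: sum_distrib_left)
    finally show "red_AC n d m (rho_ABC n d phi p m K) $$ (r, s)
        = (if r = s then of_real (p (r div m) * K (r div m) (r mod m)) else 0)"
      using dm by (simp add: norm_phi)
  qed (simp add: red_AC_def)
  also have "\<dots> = (\<Sum>i<n. \<Sum>j<m. eta (p i * K i j))"
    by (rule sum_div_mod)
  finally show ?thesis .
qed

text \<open>Tracing out A leaves a matrix block diagonal in \<open>j\<close>. C is the last tensor
  factor, so the block label is the remainder and the position is the quotient.\<close>

lemma vN_entropy_red_BC:
  "vN_entropy (red_BC n d m (rho_ABC n d phi p m K))
     = (\<Sum>j<m. vN_entropy (ensemble n d phi (\<lambda>i. p i * K i j)))"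
proof (rule vN_entropy_block[where blk = "\<lambda>r. r mod m" and pos = "\<lambda>r. r div m"])
  have "bij_betw prod.swap ({..<d} \<times> {..<m}) ({..<m} \<times> {..<d})"
    by (auto simp: bij_betw_def inj_on_def)
  from bij_betw_trans[OF bij_betw_div_mod this]
  show "bij_betw (\<lambda>r. (r mod m, r div m)) {..<d * m} ({..<m} \<times> {..<d})"
    by (simp add: o_def)
next
  fix r s assume rs: "r < d * m" "s < d * m"
  then have dm: "r div m < d" "s div m < d" "r mod m < m" "s mod m < m"
    by (auto simp: less_mult_imp_div_less intro!: mod_less_divisor intro: ccontr)
  have "red_BC n d m (rho_ABC n d phi p m K) $$ (r, s)
      = (\<Sum>x<n. if r mod m = s mod m then of_real (p x * K x (r mod m))
          * (phi x $ (r div m) * cnj (phi x $ (s div m))) else 0)"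
    using rs dm by (simp add: red_BC_def) (auto simp: rho_ABC_enc3 intro!: sum.cong)
  then show "red_BC n d m (rho_ABC n d phi p m K) $$ (r, s)
      = (if r mod m = s mod m then ensemble n d phi (\<lambda>i. p i * K i (r mod m)) $$ (r div m, s div m) else 0)"
    using dm by (simp add: ensemble_def)
qed (auto simp: red_BC_def hermitian_ensemble)

text \<open>The block at (i, j) is a weight times a rank-one projector and contributes a single
  \<eta>-term; this is where purity enters.\<close>

lemma vN_entropy_rho_ABC:
  assumes nn: "\<And>i j. i < n \<Longrightarrow> j < m \<Longrightarrow> 0 \<le> p i * K i j"
  shows "vN_entropy (rho_ABC n d phi p m K) = (\<Sum>i<n. \<Sum>j<m. eta (p i * K i j))"
proof -
  define X where "X = (\<lambda>(i, j). mat d d (\<lambda>(k, l).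
    complex_of_real (p i * K i j) * (phi i $ k * cnj (phi i $ l))))"
  have "vN_entropy (rho_ABC n d phi p m K) = (\<Sum>a\<in>{..<n} \<times> {..<m}. vN_entropy (X a))"
  proof (rule vN_entropy_block[OF _ _ bij_betw_enc3])
    fix r s assume rs: "r < n * d * m" "s < n * d * m"
    have mem: "r div (d * m) < n" "s div (d * m) < n" "r mod m < m" "s mod m < m"
       "r div m mod d < d" "s div m mod d < d"
      using rs bij_betw_enc3[of d m n] by (auto simp: bij_betw_def)
    show "rho_ABC n d phi p m K $$ (r, s)
        = (if (r div (d * m), r mod m) = (s div (d * m), s mod m)
           then X (r div (d * m), r mod m) $$ (r div m mod d, s div m mod d) else 0)"
      using rs mem by (simp add: rho_ABC_def Let_def X_def proj_phi)
  qed (auto simp: rho_ABC_def X_def hermitian_def mult_ac)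
  also have "\<dots> = (\<Sum>a\<in>{..<n} \<times> {..<m}. eta (p (fst a) * K (fst a) (snd a)))"
  proof (intro sum.cong refl)
    fix a assume "a \<in> {..<n} \<times> {..<m}"
    then obtain i j where a: "a = (i, j)" "i < n" "j < m" by auto
    have "vN_entropy (X (i, j)) = eta (p i * K i j)"
      by (rule vN_entropy_rank_one[of _ "phi i" d]) (use a states nn in \<open>auto simp: X_def\<close>)
    then show "vN_entropy (X a) = eta (p (fst a) * K (fst a) (snd a))"
      using a by simp
  qed
  finally show ?thesis
    by (simp add: sum.cartesian_product split_def)
qed

lemma weights_nonneg: "distr n p \<Longrightarrow> cond_distr n m K \<Longrightarrow> i < n \<Longrightarrow> 0 \<le> p i * K i j"
  by (simp add: distr_def cond_distr_def)

lemma cond_mutual_info_rho_ABC: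
  assumes "distr n p" "cond_distr n m K"
  shows "cond_mutual_info n d m (rho_ABC n d phi p m K)
    = (\<Sum>j<m. entropy_gap n d phi (\<lambda>i. p i * K i j))"
  using vN_entropy_rho_ABC[of m p K] weights_nonneg[OF assms]
  by (simp add: cond_mutual_info_def vN_entropy_red_AC vN_entropy_red_BC vN_entropy_red_C
      entropy_gap_def sum_subtractf)

text \<open>The chain rule \<open>eta_mult\<close> turns S(A) + S(C) - S(AC) into output entropy
  minus averaged row entropy. The first term is concave in \<open>p\<close> and the second linear,
  which is the shape needed for averaging.\<close>

lemma mutual_info_AC_rho_ABC:
  assumes p: "distr n p" and K: "cond_distr n m K"
  shows "mutual_info_AC n d m (rho_ABC n d phi p m K)
    = (\<Sum>j<m. eta (\<Sum>i<n. p i * K i j)) - (\<Sum>i<n. p i * (\<Sum>j<m. eta (K i j)))"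
proof -
  have "(\<Sum>j<m. eta (p i * K i j)) = p i * (\<Sum>j<m. eta (K i j)) + eta (p i)" if "i < n" for i
  proof -
    have Ki: "distr m (K i)" using K that by (simp add: cond_distr_def)
    then have "(\<Sum>j<m. eta (p i * K i j)) = (\<Sum>j<m. p i * eta (K i j)) + (\<Sum>j<m. K i j) * eta (p i)"
      using p by (simp add: eta_mult distrD sum.distrib flip: sum_distrib_right)
    then show ?thesis
      using distrD(3)[OF Ki] by (simp add: sum_distrib_left)
  qed
  then show ?thesis
    by (simp add: mutual_info_AC_def vN_entropy_red_A[OF K] vN_entropy_red_C vN_entropy_red_AC sum.distrib)
qed

text \<open>The receiver of the new channel holds a uniformly random \<open>g\<close> together with the output of
  \<open>K\<close> on \<open>\<pi> g i\<close>; the pair \<open>(g, j)\<close> is encoded as \<open>g * m + j\<close>.\<close>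

lemma twirled_channel:
  fixes N :: nat
  assumes N: "0 < N" and K: "cond_distr n m K" and p: "distr n p"
    and q: "\<And>g. g < N \<Longrightarrow> distr n (q g)"
    and \<pi>: "\<And>g. g < N \<Longrightarrow> bij_betw (\<pi> g) {..<n} {..<n}"
    and q\<pi>: "\<And>g i. g < N \<Longrightarrow> i < n \<Longrightarrow> q g (\<pi> g i) = p i"
    and gap: "\<And>g w. g < N \<Longrightarrow> entropy_gap n d phi (\<lambda>i. w (\<pi> g i)) = entropy_gap n d phi w"
    and r: "distr n r" "\<And>i. i < n \<Longrightarrow> r i = (\<Sum>g<N. q g i) / real N"
  obtains m' K' where "cond_distr n m' K'"
    "mutual_info_AC n d m' (rho_ABC n d phi p m' K') \<le> mutual_info_AC n d m (rho_ABC n d phi r m K)"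
    "cond_mutual_info n d m' (rho_ABC n d phi p m' K') \<le> cond_mutual_info n d m (rho_ABC n d phi r m K)"
proof -
  \<comment> \<open>Outputs beyond \<open>N * m\<close> get weight zero, as \<open>distr\<close>
    demands.\<close>
  define K' where "K' = (\<lambda>i s. if s < N * m then K (\<pi> (s div m) i) (s mod m) / real N else 0)"
  have \<pi>n: "\<pi> g i < n" if "g < N" "i < n" for g i
    using \<pi>[OF that(1)] that(2) by (auto simp: bij_betw_def)
  have Kn: "distr m (K i)" if "i < n" for i
    using K that by (simp add: cond_distr_def)
  \<comment> \<open>\<open>F\<close> is an arbitrary functional of a channel column, because the
    same splitting of the output sum serves normalisation, both entropies and the entropy
    gaps.\<close>
  have sum_K': "(\<Sum>s<N * m. F (\<lambda>i. K' i s)) = (\<Sum>g<N. \<Sum>j<m. F (\<lambda>i. K (\<pi> g i) j / real N))"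
    for F :: "(nat \<Rightarrow> real) \<Rightarrow> real"
    unfolding sum_div_mod[symmetric] by (simp add: K'_def)
  have reix: "(\<Sum>i<n. p i * f (\<pi> g i)) = (\<Sum>i<n. q g i * f i)" if "g < N" for g f
  proof -
    have "(\<Sum>i<n. p i * f (\<pi> g i)) = (\<Sum>i<n. q g (\<pi> g i) * f (\<pi> g i))"
      using q\<pi> that by simp
    also have "\<dots> = (\<Sum>i<n. q g i * f i)"
      by (rule sum.reindex_bij_betw[OF \<pi>[OF that]])
    finally show ?thesis .
  qed
  have avg: "(\<Sum>g<N. (\<Sum>i<n. q g i * f i) / real N) = (\<Sum>i<n. r i * f i)" for f
  proof -
    have "(\<Sum>g<N. (\<Sum>i<n. q g i * f i) / real N) = (\<Sum>g<N. \<Sum>i<n. q g i * f i / real N)"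
      by (simp add: sum_divide_distrib)
    also have "\<dots> = (\<Sum>i<n. \<Sum>g<N. q g i * f i / real N)"
      by (rule sum.swap)
    also have "\<dots> = (\<Sum>i<n. r i * f i)"
      by (intro sum.cong refl) (simp add: r(2) sum_divide_distrib sum_distrib_right)
    finally show ?thesis .
  qed
  have cK': "cond_distr n (N * m) K'"
    unfolding cond_distr_def
  proof (intro allI impI)
    fix i assume i: "i < n"
    have "(\<Sum>s<N * m. K' i s) = (\<Sum>g<N. (\<Sum>j<m. K (\<pi> g i) j) / real N)"
      using sum_K'[of "\<lambda>f. f i"] by (simp add: sum_divide_distrib)
    also have "\<dots> = 1"
      using N i by (simp add: distrD(3)[OF Kn] \<pi>n)
    finally have "(\<Sum>s<N * m. K' i s) = 1" .
    moreover have "0 \<le> K' i s" for s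
    proof (cases "s < N * m")
      case True
      then have "s div m < N" by (rule less_mult_imp_div_less)
      then show ?thesis
        using distrD(1)[OF Kn[OF \<pi>n]] i by (simp add: K'_def)
    qed (simp add: K'_def)
    ultimately show "distr (N * m) (K' i)"
      by (simp add: distr_def K'_def)
  qed
  \<comment> \<open>This is log N, the entropy of the uniform label. It appears in the output
    entropy and in the averaged row entropy, and cancels in their difference.\<close>
  define c where "c = real N * eta (1 / real N)"
  have out: "(\<Sum>s<N * m. eta (\<Sum>i<n. p i * K' i s)) \<le> (\<Sum>j<m. eta (\<Sum>i<n. r i * K i j)) + c"
  proof -
    define b where "b = (\<lambda>g j. \<Sum>i<n. q g i * K i j)"
    have b0: "0 \<le> b g j" if "g < N" for g j
      unfolding b_def using distrD(1)[OF q[OF that]] distrD(1)[OF Kn] by (intro sum_nonneg) auto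
    have b1: "(\<Sum>j<m. b g j) = 1" if "g < N" for g
    proof -
      have "(\<Sum>j<m. b g j) = (\<Sum>i<n. q g i * (\<Sum>j<m. K i j))"
        unfolding b_def sum_distrib_left by (rule sum.swap)
      also have "\<dots> = (\<Sum>i<n. q g i)"
        by (intro sum.cong refl) (simp add: distrD(3)[OF Kn])
      finally show ?thesis using distrD(3)[OF q[OF that]] by simp
    qed
    have "(\<Sum>s<N * m. eta (\<Sum>i<n. p i * K' i s)) = (\<Sum>g<N. \<Sum>j<m. eta (\<Sum>i<n. p i * (K (\<pi> g i) j / real N)))"
      by (rule sum_K')
    also have "\<dots> = (\<Sum>g<N. \<Sum>j<m. eta (1 / real N * b g j))"
      using reix[of _ "\<lambda>i. K i _ / real N"] by (intro sum.cong refl) (simp add: b_def sum_divide_distrib)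
    also have "\<dots> = (\<Sum>g<N. \<Sum>j<m. 1 / real N * eta (b g j) + b g j * eta (1 / real N))"
      by (intro sum.cong refl eta_mult) (use b0 in auto)
    also have "\<dots> = (\<Sum>g<N. \<Sum>j<m. 1 / real N * eta (b g j)) + c"
      by (simp add: sum.distrib b1 c_def flip: sum_distrib_right)
    also have "(\<Sum>g<N. \<Sum>j<m. 1 / real N * eta (b g j)) = (\<Sum>j<m. \<Sum>g<N. 1 / real N * eta (b g j))"
      by (rule sum.swap)
    \<comment> \<open>The only inequality on the S(A:C) side: concavity of the output entropy under
      averaging of the input distributions \<open>q g\<close>.\<close>
    also have "\<dots> \<le> (\<Sum>j<m. eta (\<Sum>g<N. 1 / real N * b g j))"
      using N b0 by (intro sum_mono eta_jensen) auto
    also have "\<dots> = (\<Sum>j<m. eta (\<Sum>i<n. r i * K i j))"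
      by (simp add: b_def flip: avg)
    finally show ?thesis by simp
  qed
  \<comment> \<open>An equality, because the averaged row entropy is linear in the input
    distribution.\<close>
  have cond: "(\<Sum>i<n. p i * (\<Sum>s<N * m. eta (K' i s))) = (\<Sum>i<n. r i * (\<Sum>j<m. eta (K i j))) + c"
  proof -
    define H where "H = (\<lambda>i. \<Sum>j<m. eta (K i j))"
    have HK: "(\<Sum>j<m. eta (K i j / real N)) = H i / real N + eta (1 / real N)" if "i < n" for i
    proof -
      have "(\<Sum>j<m. eta (K i j / real N)) = (\<Sum>j<m. eta (1 / real N * K i j))" by simp
      also have "\<dots> = (\<Sum>j<m. 1 / real N * eta (K i j) + K i j * eta (1 / real N))"
        using distrD(1)[OF Kn[OF that]] by (intro sum.cong refl eta_mult) auto
      also have "\<dots> = H i / real N + (\<Sum>j<m. K i j) * eta (1 / real N)"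
        by (simp add: H_def sum.distrib sum_divide_distrib sum_distrib_right)
      finally show ?thesis using distrD(3)[OF Kn[OF that]] by simp
    qed
    have "(\<Sum>i<n. p i * (\<Sum>s<N * m. eta (K' i s))) = (\<Sum>i<n. \<Sum>g<N. p i * (\<Sum>j<m. eta (K (\<pi> g i) j / real N)))"
      using sum_K'[of "\<lambda>f. eta (f _)"] by (simp add: sum_distrib_left)
    also have "\<dots> = (\<Sum>g<N. \<Sum>i<n. p i * (\<Sum>j<m. eta (K (\<pi> g i) j / real N)))"
      by (rule sum.swap)
    also have "\<dots> = (\<Sum>g<N. (\<Sum>i<n. p i * H (\<pi> g i)) / real N + eta (1 / real N))"
    proof (intro sum.cong refl)
      fix g assume "g \<in> {..<N}"
      then have "(\<Sum>i<n. p i * (\<Sum>j<m. eta (K (\<pi> g i) j / real N)))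
          = (\<Sum>i<n. p i * H (\<pi> g i) / real N + p i * eta (1 / real N))"
        by (intro sum.cong refl) (simp add: HK \<pi>n distrib_left)
      also have "\<dots> = (\<Sum>i<n. p i * H (\<pi> g i)) / real N + (\<Sum>i<n. p i) * eta (1 / real N)"
        by (simp add: sum.distrib sum_divide_distrib sum_distrib_right)
      finally show "(\<Sum>i<n. p i * (\<Sum>j<m. eta (K (\<pi> g i) j / real N)))
          = (\<Sum>i<n. p i * H (\<pi> g i)) / real N + eta (1 / real N)"
        using distrD(3)[OF p] by simp
    qed
    also have "\<dots> = (\<Sum>g<N. (\<Sum>i<n. q g i * H i) / real N) + c"
      by (simp add: sum.distrib c_def reix)
    also have "\<dots> = (\<Sum>i<n. r i * H i) + c"
      by (simp only: avg)
    finally show ?thesis by (simp add: H_def)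
  qed
  have "mutual_info_AC n d (N * m) (rho_ABC n d phi p (N * m) K')
      \<le> mutual_info_AC n d m (rho_ABC n d phi r m K)"
    unfolding mutual_info_AC_rho_ABC[OF p cK'] mutual_info_AC_rho_ABC[OF r(1) K]
    using out cond by simp
  moreover have "cond_mutual_info n d (N * m) (rho_ABC n d phi p (N * m) K')
      \<le> cond_mutual_info n d m (rho_ABC n d phi r m K)"
  proof -
    have "(\<Sum>s<N * m. entropy_gap n d phi (\<lambda>i. p i * K' i s))
        = (\<Sum>g<N. \<Sum>j<m. entropy_gap n d phi (\<lambda>i. p i * (K (\<pi> g i) j / real N)))"
      by (rule sum_K')
    also have "\<dots> = (\<Sum>g<N. \<Sum>j<m. entropy_gap n d phi (\<lambda>i. q g (\<pi> g i) * (K (\<pi> g i) j / real N)))"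
      by (intro sum.cong refl entropy_gap_cong) (simp add: q\<pi>)
    \<comment> \<open>All weights are now functions of \<open>\<pi> g i\<close>, so covariance
      removes the permutation and the \<open>N\<close> ensembles live in one common frame, ready to
      be merged.\<close>
    also have "\<dots> = (\<Sum>g<N. \<Sum>j<m. entropy_gap n d phi (\<lambda>i. q g i * (K i j / real N)))"
      using gap[of _ "\<lambda>i. q _ i * (K i _ / real N)"] by (intro sum.cong refl) simp
    also have "\<dots> = (\<Sum>j<m. \<Sum>g<N. entropy_gap n d phi (\<lambda>i. q g i * (K i j / real N)))"
      by (rule sum.swap)
    also have "\<dots> \<le> (\<Sum>j<m. entropy_gap n d phi (\<lambda>i. \<Sum>g<N. q g i * (K i j / real N)))"
      using distrD(1)[OF q] distrD(1)[OF Kn] by (intro sum_mono entropy_gap_superadditive) auto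
    also have "\<dots> = (\<Sum>j<m. entropy_gap n d phi (\<lambda>i. r i * K i j))"
      by (intro sum.cong refl entropy_gap_cong) (simp add: r(2) sum_divide_distrib sum_distrib_right)
    finally show ?thesis
      unfolding cond_mutual_info_rho_ABC[OF p cK'] cond_mutual_info_rho_ABC[OF r(1) K] .
  qed
  ultimately show thesis using cK' that by blast
qed

section \<open>Bounds and comparison for the infimum over channels\<close>

definition feasible :: "(nat \<Rightarrow> real) \<Rightarrow> real \<Rightarrow> real set" where
  "feasible p R = {cond_mutual_info n d m (rho_ABC n d phi p m K) | m K.
     cond_distr n m K \<and> mutual_info_AC n d m (rho_ABC n d phi p m K) \<le> R}"

lemma M_p_feasible: "M_p n d phi p R = Inf (feasible p R)"
  by (simp add: M_p_def feasible_def)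

lemma feasible_nonneg:
  assumes "distr n p" "x \<in> feasible p R"
  shows "0 \<le> x"
  using assms by (auto simp: feasible_def cond_mutual_info_rho_ABC weights_nonneg
      intro!: sum_nonneg entropy_gap_nonneg)

lemma bdd_below_feasible: "distr n p \<Longrightarrow> bdd_below (feasible p R)"
  using feasible_nonneg by (intro bdd_belowI) auto

text \<open>A constant output carries no information about A, so it meets the constraint for every
  \<open>R \<ge> 0\<close>. It makes the feasible set nonempty and bounds its infimum from
  above.\<close>

lemma trivial_channel_feasible:
  assumes p: "distr n p" and R: "0 \<le> R"
  shows "entropy_gap n d phi p \<in> feasible p R"
proof -
  define K where "K = (\<lambda>(i :: nat) (j :: nat). if j = 0 then 1 else 0 :: real)"
  have K: "cond_distr n 1 K"
    by (auto simp: cond_distr_def distr_def K_def)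
  have "mutual_info_AC n d 1 (rho_ABC n d phi p 1 K) = 0"
    unfolding mutual_info_AC_rho_ABC[OF p K] using distrD(3)[OF p] by (simp add: K_def)
  moreover have "cond_mutual_info n d 1 (rho_ABC n d phi p 1 K) = entropy_gap n d phi p"
    unfolding cond_mutual_info_rho_ABC[OF p K] by (simp add: K_def)
  ultimately show ?thesis
    using K R unfolding feasible_def by force
qed

lemma M_p_le:
  assumes p: "distr n p" and R: "0 \<le> R"
  shows "M_p n d phi p R \<le> real d / ln 2"
proof -
  have "M_p n d phi p R \<le> entropy_gap n d phi p"
    unfolding M_p_feasible
    by (intro cInf_lower trivial_channel_feasible bdd_below_feasible assms)
  also have "\<dots> \<le> real d / ln 2"
    using vN_entropy_le_dim[OF hermitian_ensemble, of p] distrD(3)[OF p] by (simp add: entropy_gap_def)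
  finally show ?thesis .
qed

text \<open>Every value attained for \<open>r\<close> dominates one attained for \<open>p\<close>
  under the same bound \<open>R\<close>, by the twirled channel; comparing infima then gives the
  claim.\<close>

lemma M_p_twirl_le:
  fixes N :: nat
  assumes N: "0 < N" and p: "distr n p" and R: "0 \<le> R"
    and q: "\<And>g. g < N \<Longrightarrow> distr n (q g)"
    and \<pi>: "\<And>g. g < N \<Longrightarrow> bij_betw (\<pi> g) {..<n} {..<n}"
    and q\<pi>: "\<And>g i. g < N \<Longrightarrow> i < n \<Longrightarrow> q g (\<pi> g i) = p i"
    and gap: "\<And>g w. g < N \<Longrightarrow> entropy_gap n d phi (\<lambda>i. w (\<pi> g i)) = entropy_gap n d phi w"
    and r: "distr n r" "\<And>i. i < n \<Longrightarrow> r i = (\<Sum>g<N. q g i) / real N"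
  shows "M_p n d phi p R \<le> M_p n d phi r R"
  unfolding M_p_feasible
proof (rule cInf_mono)
  show "feasible r R \<noteq> {}"
    using trivial_channel_feasible[OF r(1) R] by auto
  show "bdd_below (feasible p R)"
    by (rule bdd_below_feasible[OF p])
  fix x assume "x \<in> feasible r R"
  then obtain m K where K: "cond_distr n m K" and x: "x = cond_mutual_info n d m (rho_ABC n d phi r m K)"
    and mi: "mutual_info_AC n d m (rho_ABC n d phi r m K) \<le> R"
    by (auto simp: feasible_def)
  obtain m' K' where "cond_distr n m' K'"
    "mutual_info_AC n d m' (rho_ABC n d phi p m' K') \<le> mutual_info_AC n d m (rho_ABC n d phi r m K)"
    "cond_mutual_info n d m' (rho_ABC n d phi p m' K') \<le> cond_mutual_info n d m (rho_ABC n d phi r m K)"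
    by (rule twirled_channel[OF N K p q \<pi> q\<pi> gap r])
  then show "\<exists>a\<in>feasible p R. a \<le> x"
    using mi unfolding feasible_def x by fastforce
qed

end

section \<open>Symmetrisation\<close>

text \<open>Induction on the number of points: the first \<open>k\<close> weights are rescaled by
  their sum \<open>s\<close> and mixed with the last point. For \<open>s = 0\<close> only the last
  point remains, and the empty combination is excluded because its weights add up to 0.\<close>

lemma conv_distr_convex:
  assumes convex: "\<And>p q t. p \<in> S \<Longrightarrow> q \<in> S \<Longrightarrow> 0 \<le> t \<Longrightarrow> t \<le> 1 \<Longrightarrow>
      (\<lambda>i. t * p i + (1 - t) * q i) \<in> S"
  shows "conv_distr S = S"
proof (rule subset_antisym)
  have "(\<lambda>i. \<Sum>l<k. c l * q l i) \<in> S"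
    if "\<forall>l<k. 0 \<le> c l \<and> q l \<in> S" "(\<Sum>l<k. c l) = 1" for k and c :: "nat \<Rightarrow> real" and q
    using that
  proof (induction k arbitrary: c)
    case (Suc k)
    define s where "s = (\<Sum>l<k. c l)"
    have s0: "0 \<le> s" unfolding s_def using Suc.prems(1) by (intro sum_nonneg) auto
    have ck: "c k = 1 - s" "0 \<le> c k" "q k \<in> S" using Suc.prems by (simp_all add: s_def)
    show ?case
    proof (cases "s = 0")
      case True
      then have "c l = 0" if "l < k" for l
        using that Suc.prems(1) sum_nonneg_eq_0_iff[of "{..<k}" c] unfolding s_def by auto
      then show ?thesis using ck True by simp
    next
      case False
      have "(\<lambda>i. \<Sum>l<k. c l / s * q l i) \<in> S"
        using Suc.prems(1) s0 False by (intro Suc.IH) (auto simp: s_def simp flip: sum_divide_distrib)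
      then have "(\<lambda>i. s * (\<Sum>l<k. c l / s * q l i) + (1 - s) * q k i) \<in> S"
        using ck s0 by (intro convex) auto
      then show ?thesis using False ck by (simp add: sum_distrib_left)
    qed
  qed simp
  then show "conv_distr S \<subseteq> S"
    by (auto simp: conv_distr_def)
  show "S \<subseteq> conv_distr S"
  proof
    fix p assume "p \<in> S"
    then show "p \<in> conv_distr S"
      unfolding conv_distr_def
      by (intro CollectI exI[of _ 1] exI[of _ "\<lambda>_. 1"] exI[of _ "\<lambda>_. p"]) auto
  qed
qed

theorem theorem9p1:
  fixes G :: "('g, 'b) monoid_scheme"
    and act :: "'g \<Rightarrow> nat \<Rightarrow> nat"
    and U :: "'g \<Rightarrow> complex mat"
    and n d :: nat
    and phi :: "nat \<Rightarrow> complex vec"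
    and P :: "(nat \<Rightarrow> real) set"
    and R :: real
  assumes states: "\<And>i. i < n \<Longrightarrow> phi i \<in> carrier_vec d \<and> (\<Sum>k<d. (cmod (phi i $ k))\<^sup>2) = 1"
    and grp: "group G" and fin: "finite (carrier G)"
    and action: "group_action G {..<n} act"
    and unit: "\<And>g. g \<in> carrier G \<Longrightarrow> unitary_mat d (U g)"
    and cov: "\<And>g i. g \<in> carrier G \<Longrightarrow> i < n \<Longrightarrow>
               proj (phi (act g i)) = U g * proj (phi i) * mat_adjoint (U g)"
    and P_distr: "\<And>p. p \<in> P \<Longrightarrow> distr n p"
    and P_ne: "P \<noteq> {}"
    and P_convex: "\<And>p q t. p \<in> P \<Longrightarrow> q \<in> P \<Longrightarrow> 0 \<le> t \<Longrightarrow> t \<le> 1 \<Longrightarrow>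
               (\<lambda>i. t * p i + (1 - t) * q i) \<in> P"
    and P_stable: "\<And>p g. p \<in> P \<Longrightarrow> g \<in> carrier G \<Longrightarrow> act_distr G act n g p \<in> P"
    and R: "0 \<le> R"
  shows "M_set n d phi P R =
         M_set n d phi {p \<in> P. \<forall>g \<in> carrier G. act_distr G act n g p = p} R"
proof -
  interpret group G by (rule grp)
  interpret group_action G "{..<n}" act by (rule action)
  interpret pure_states n d phi by unfold_locales (rule states)
  let ?PG = "{p \<in> P. \<forall>g \<in> carrier G. act_distr G act n g p = p}"
  define N where "N = card (carrier G)"
  have N: "0 < N" unfolding N_def using fin one_closed by (auto simp: card_gt_0_iff)
  \<comment> \<open>The channel construction encodes the label in a natural number, so the group is
    enumerated.\<close>
  obtain h where h: "bij_betw h {..<N} (carrier G)"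
    using ex_bij_betw_nat_finite[OF fin] by (auto simp: N_def atLeast0LessThan)
  have hG: "h k \<in> carrier G" if "k < N" for k
    using h that by (auto simp: bij_betw_def)
  have bij_act: "bij_betw (act g) {..<n} {..<n}" if "g \<in> carrier G" for g
    using inj_prop[OF that] surj_prop[OF that] by (simp add: bij_betw_def)
  have act_n: "act g i < n" if "g \<in> carrier G" "i < n" for g i
    using bij_act[OF that(1)] that(2) by (auto simp: bij_betw_def)
  have convP: "conv_distr P = P"
    using P_convex by (rule conv_distr_convex)
  have convPG: "conv_distr ?PG = ?PG"
  proof (rule conv_distr_convex)
    fix p q and t :: real
    assume pq: "p \<in> ?PG" "q \<in> ?PG" and t: "0 \<le> t" "t \<le> 1"
    have "act_distr G act n g (\<lambda>i. t * p i + (1 - t) * q i) = (\<lambda>i. t * p i + (1 - t) * q i)"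
      if g: "g \<in> carrier G" for g
    proof -
      have "act_distr G act n g (\<lambda>i. t * p i + (1 - t) * q i)
          = (\<lambda>i. t * act_distr G act n g p i + (1 - t) * act_distr G act n g q i)"
        by (auto simp: act_distr_def)
      then show ?thesis using pq g by simp
    qed
    then show "(\<lambda>i. t * p i + (1 - t) * q i) \<in> ?PG"
      using pq t P_convex by simp
  qed
  have twirl: "\<exists>r\<in>?PG. M_p n d phi p R \<le> M_p n d phi r R" if pP: "p \<in> P" for p
  proof -
    define r where "r = (\<lambda>i. (\<Sum>g\<in>carrier G. act_distr G act n g p i) / real N)"
    have r_eq: "r i = (\<Sum>k<N. act_distr G act n (h k) p i) / real N" for i
      unfolding r_def using sum.reindex_bij_betw[OF h, of "\<lambda>g. act_distr G act n g p i"] by simp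
    have "r = (\<lambda>i. \<Sum>k<N. 1 / real N * act_distr G act n (h k) p i)"
      by (simp add: r_eq fun_eq_iff sum_divide_distrib)
    \<comment> \<open>Convexity of \<open>P\<close> is given for two points; the average of
      \<open>N\<close> points is reached through \<open>conv_distr P = P\<close>.\<close>
    then have "r \<in> conv_distr P"
      unfolding conv_distr_def using N P_stable[OF pP] hG
      by (intro CollectI exI[of _ N] exI[of _ "\<lambda>_. 1 / real N"] exI[of _ "\<lambda>k. act_distr G act n (h k) p"]) auto
    then have rP: "r \<in> P" by (simp only: convP)
    have "act_distr G act n g r = r" if g: "g \<in> carrier G" for g
    proof
      fix i
      show "act_distr G act n g r i = r i"
      proof (cases "i < n")
        case True
        have bij: "bij_betw (\<lambda>k. g \<otimes>\<^bsub>G\<^esub> k) (carrier G) (carrier G)"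
          using inj_on_cmult[OF g] surj_const_mult[OF g] by (simp add: bij_betw_def)
        \<comment> \<open>Both sides evaluate \<open>p\<close> at the inverse of the product g k
          applied to \<open>i\<close>. Left translation by \<open>g\<close> therefore only permutes
          the summands of \<open>r\<close>.\<close>
        have "act_distr G act n k p (act (inv\<^bsub>G\<^esub> g) i) = act_distr G act n (g \<otimes>\<^bsub>G\<^esub> k) p i"
          if k: "k \<in> carrier G" for k
          using True g k by (simp add: act_distr_def act_n inv_mult_group composition_rule)
        then have "act_distr G act n g r i = (\<Sum>k\<in>carrier G. act_distr G act n (g \<otimes>\<^bsub>G\<^esub> k) p i) / real N"
          using True by (simp add: r_def act_distr_def[of _ _ _ g])
        then show ?thesis
          using sum.reindex_bij_betw[OF bij, of "\<lambda>k. act_distr G act n k p i"] by (simp add: r_def)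
      qed (simp add: act_distr_def r_def)
    qed
    then have "r \<in> ?PG" using rP by simp
    moreover have "M_p n d phi p R \<le> M_p n d phi r R"
    proof (rule M_p_twirl_le[OF N P_distr[OF pP] R])
      fix k assume k: "k < N"
      note g = hG[OF k]
      show "distr n (act_distr G act n (h k) p)"
        using P_distr P_stable[OF pP g] by simp
      show "bij_betw (act (h k)) {..<n} {..<n}"
        by (rule bij_act[OF g])
      \<comment> \<open>The inverse in \<open>act_distr\<close> cancels the action on the
        point.\<close>
      show "act_distr G act n (h k) p (act (h k) i) = p i" if "i < n" for i
        using act_n[OF g that] orbit_sym_aux[OF g, of i "act (h k) i"] that by (simp add: act_distr_def)
      show "entropy_gap n d phi (\<lambda>i. w (act (h k) i)) = entropy_gap n d phi w" for w
        by (rule entropy_gap_covariant[OF bij_act[OF g] unit[OF g] cov[OF g]])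
    qed (use P_distr rP r_eq in auto)
    ultimately show ?thesis by blast
  qed
  have bdd: "bdd_above ((\<lambda>p. M_p n d phi p R) ` P)"
    using M_p_le[OF P_distr R] by (intro bdd_aboveI2)
  \<comment> \<open>Twirling any point of \<open>P\<close> produces an invariant one.\<close>
  have ne: "?PG \<noteq> {}" using P_ne twirl by blast
  show ?thesis
    unfolding M_set_def convP convPG
  proof (rule antisym)
    show "Sup ((\<lambda>p. M_p n d phi p R) ` P) \<le> Sup ((\<lambda>p. M_p n d phi p R) ` ?PG)"
      using P_ne twirl bdd by (intro cSUP_mono bdd_above_mono[OF bdd]) auto
    show "Sup ((\<lambda>p. M_p n d phi p R) ` ?PG) \<le> Sup ((\<lambda>p. M_p n d phi p R) ` P)"
      using ne by (intro cSUP_subset_mono bdd) auto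
  qed
qed

end
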